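(* The HMDGFE Algorithm is consistent, in the following sense. Let $(\mathbf u,p,c)$ be the solution of the miscible displacement problem, and set $\boldsymbol\sigma=-D(\mathbf u)\nabla c$, $\lambda=p$, $\lambda^c=c$. Then the variational equations of the algorithm hold with the discrete quantities replaced by the exact ones: for $n=1,2,\dots,M$ and all $(\boldsymbol\tau_h,v_h,\mu_h)\in\Theta_h\times\Lambda_h\times\Sigma_h$, (a) $B_{\mathbf u}(c^{n-1};(\mathbf u^n,p^n,\lambda^n),(\boldsymbol\tau_h,v_h,\mu_h))=-(q^n,v_h)_{\mathcal T_h}$, (b) $B_c(\mathbf u^n;(\boldsymbol\sigma^n,c^n,\lambda^{c,n}),(\boldsymbol\tau_h,v_h,\mu_h))=-(q^nc^{*,n}+\frac{\phi}{\Delta t}c^{n-1},v_h)_{\mathcal T_h}$.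
   Context: Problem. $\Omega\subset\mathbb R^d$ ($d=2,3$) is a bounded polygonal/polyhedral domain with unit outward normal $\mathbf n$. The unknowns are the pressure $p$, Darcy velocity $\mathbf u$ and concentration $c$ on $\Omega\times[0,T]$, with $\nabla\cdot\mathbf u=q$, $\mathbf u=-\frac{k^*}{\mu(c)}\nabla p$, $\phi\,\partial_tc+\nabla\cdot(\mathbf uc-D(\mathbf u)\nabla c)=qc^*$ in $\Omega$, $\mathbf u\cdot\mathbf n=0$ and $D(\mathbf u)\nabla c\cdot\mathbf n=0$ on $\partial\Omega$, $c(x,0)=c_0(x)$. Here $k^*(x)$, $\phi(x)$, $\mu(c)$ are permeability, porosity, viscosity; $q(x,t)$ is the source; $c^*$ is prescribed where $q>0$ and equals $c$ where $q<0$. $D(\mathbf u)=\phi[d_mI+|\mathbf u|(d_lE(\mathbf u)+d_tE^\perp(\mathbf u))]$ with $E(\mathbf u)=(u_iu_j/|\mathbf u|^2)_{d\times d}$, $E^\perp=I-E$, constants $d_m>0$, $d_l,d_t\ge0$. Put $a(c)=\mu(c)/k^*$. Mesh and spaces. $\mathcal T_h$ is a quasi-uniform regular partition of $\Omega$ into elements $K$; $\partial\mathcal T_h$ is the set of all element edges/faces $e$. $(u,v)_{\mathcal T_h}=\sum_K\int_Kuv\,dx$, $\langle u,v\rangle_{\partial\mathcal T_h}=\sum_K\int_{\partial K}uv\,ds$ ($\mathbf n$ is the outward normal of $K$ on $\partial K$; derivatives are elementwise). $\Lambda_h=\{v\in L^2:v|_K\in P_k(K)\ \forall K\}$, $\Theta_h=\{v\in[L^2]^d:v|_K\in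 RT_k(K)\ \forall K\}$ with $RT_k(K)=[P_k(K)]^d\oplus xP_k(K)$ (no interelement continuity), $\Sigma_h=\{v\in L^2(\partial\mathcal T_h):v|_e\in P_k(e)\ \forall e\}$ (single valued on each $e$). Time: $\Delta t=T/M$, $t^n=n\Delta t$, $w^n=w(\cdot,t^n)$. Forms. For a velocity field $\mathbf w$, $\partial K^{out}=\{x\in\partial K:\mathbf w\cdot\mathbf n>0\}$, $\partial K^{in}=\partial K\setminus\partial K^{out}$. Given $(c,\lambda^c)$, $\hat c=\lambda^c$ on $\partial K^{in}$ and $\hat c=c$ on $\partial K^{out}$. Define $B_{\mathbf u}(\tilde c;(\mathbf u,p,\lambda),(\boldsymbol\tau,v,\mu))=(a(\tilde c)\mathbf u,\boldsymbol\tau)_{\mathcal T_h}+(\nabla p,\boldsymbol\tau)_{\mathcal T_h}+(\mathbf u,\nabla v)_{\mathcal T_h}+\langle\lambda-p,\boldsymbol\tau\cdot\mathbf n\rangle_{\partial\mathcal T_h}+\langle\mathbf u\cdot\mathbf n,\mu-v\rangle_{\partial\mathcal T_h}$, $B_c(\mathbf w;(\boldsymbol\sigma,c,\lambda^c),(\boldsymbol\tau,v,\mu))=-\frac1{\Delta t}(\phi c,v)_{\mathcal T_h}+(\boldsymbol\sigma+\mathbf wc,\nabla v)_{\mathcal T_h}+(D(\mathbf w)^{-1}\boldsymbol\sigma+\nabla c,\boldsymbol\tau)_{\mathcal T_h}+\langle\lambda^c-c,\boldsymbol\tau\cdot\mathbf n\rangle_{\partial\mathcal T_h}+\langle\boldsymbol\sigma\cdot\mathbf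 n+\mathbf w\cdot\mathbf n\,\hat c,\mu-v\rangle_{\partial\mathcal T_h}$. HMDGFE Algorithm. Given $c_h^0\in\Lambda_h$, for $n=1,\dots,M$ find $(\mathbf u_h^n,p_h^n,\lambda_h^n)$ and $(\boldsymbol\sigma_h^n,c_h^n,\lambda_h^{c,n})$ in $\Theta_h\times\Lambda_h\times\Sigma_h$ such that for all $(\boldsymbol\tau_h,v_h,\mu_h)\in\Theta_h\times\Lambda_h\times\Sigma_h$: $B_{\mathbf u}(c_h^{n-1};(\mathbf u_h^n,p_h^n,\lambda_h^n),(\boldsymbol\tau_h,v_h,\mu_h))=-(q^n,v_h)_{\mathcal T_h}$ and $B_c(\mathbf u_h^n;(\boldsymbol\sigma_h^n,c_h^n,\lambda_h^{c,n}),(\boldsymbol\tau_h,v_h,\mu_h))=-(q^nc_h^{*,n}+\frac{\phi}{\Delta t}c_h^{n-1},v_h)_{\mathcal T_h}$, where $c_h^{*,n}$ is the prescribed value $c^{*,n}$ where $q^n>0$ and equals $c_h^n$ where $q^n<0$.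
   Formalization: As stated (a),(b) fail: for a classical exact solution on conforming simplices they hold with added terms ((a(c^{n-1})-a(c^n))u^n,τ_h) and (φ(∂_t c^n-(c^n-c^{n-1})/Δt),v_h); they hold verbatim if ∂_t c^n is the difference quotient and the viscosity is taken at c^{n-1}. *)

theory Defs
  imports "HOL-Analysis.Analysis"
begin

section \<open>Differential operators\<close>

text \<open>
  Derivatives are taken within a set \<open>S\<close>, which is a closed element of the mesh (elementwise
  derivatives) or the closure of the domain (derivatives of the exact solution, including those
  at the boundary).  At an interior point of \<open>S\<close> they are the usual ones.
\<close>

definition grad :: "(real^'n) set \<Rightarrow> (real^'n \<Rightarrow> real) \<Rightarrow> real^'n \<Rightarrow> real^'n" where
  "grad S f x = (\<chi> i. frechet_derivative f (at x within S) (axis i 1))"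

definition divg :: "(real^'n) set \<Rightarrow> (real^'n \<Rightarrow> real^'n) \<Rightarrow> real^'n \<Rightarrow> real" where
  "divg S F x = trace (jacobian F (at x within S))"

definition C1_on :: "(real^'n) set \<Rightarrow> (real^'n \<Rightarrow> 'b::real_normed_vector) \<Rightarrow> bool" where
  "C1_on S f \<longleftrightarrow>
     f differentiable_on S \<and>
     (\<forall>h. continuous_on S (\<lambda>x. frechet_derivative f (at x within S) h))"


section \<open>Domain and mesh\<close>

text \<open>
  The condition \<open>interior (closure \<Omega>) = \<Omega>\<close> excludes slits and isolated boundary points.
\<close>

definition polyhedral_domain :: "(real^'n) set \<Rightarrow> bool" where
  "polyhedral_domain \<Omega> \<longleftrightarrow>
     open \<Omega> \<and> connected \<Omega> \<and> bounded \<Omega> \<and> \<Omega> \<noteq> {} \<and> interior (closure \<Omega>) = \<Omega> \<and>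
     (\<exists>\<P>. finite \<P> \<and> (\<forall>P\<in>\<P>. polytope P) \<and> closure \<Omega> = \<Union>\<P>)"

text \<open>
  \<open>\<nu>\<close> is the unit outward normal of \<open>\<Omega>\<close> at \<open>x\<close>: near \<open>x\<close> the domain is the half space below the
  hyperplane through \<open>x\<close> orthogonal to \<open>\<nu>\<close>.  On the boundary of a polyhedral domain such a \<open>\<nu>\<close>
  exists away from the vertices (and, in three dimensions, edges) of the domain.
\<close>

definition domain_normal :: "(real^'n) set \<Rightarrow> real^'n \<Rightarrow> real^'n \<Rightarrow> bool" where
  "domain_normal \<Omega> x \<nu> \<longleftrightarrow>
     norm \<nu> = 1 \<and> (\<exists>r>0. \<Omega> \<inter> ball x r = {y \<in> ball x r. \<nu> \<bullet> (y - x) < 0})"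

text \<open>
  Elements are closed simplices of full dimension, and \<open>triangulation\<close> makes the mesh conforming.
  \<open>\<kappa>\<close> is the shape-regularity and quasi-uniformity constant.
\<close>

definition quasi_uniform_mesh :: "real \<Rightarrow> (real^'n) set \<Rightarrow> (real^'n) set set \<Rightarrow> bool" where
  "quasi_uniform_mesh \<kappa> \<Omega> \<T> \<longleftrightarrow>
     triangulation \<T> \<and> (\<forall>K\<in>\<T>. int CARD('n) simplex K) \<and> \<Union>\<T> = closure \<Omega> \<and>
     (\<forall>K\<in>\<T>. \<exists>z r. r > 0 \<and> ball z r \<subseteq> K \<and> diameter K \<le> \<kappa> * r) \<and>
     (\<forall>K\<in>\<T>. \<forall>K'\<in>\<T>. diameter K \<le> \<kappa> * diameter K')"

definition mesh_faces :: "(real^'n) set set \<Rightarrow> (real^'n) set set" where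
  "mesh_faces \<T> = {e. \<exists>K\<in>\<T>. e facet_of K}"

definition face_normal :: "(real^'n) set \<Rightarrow> (real^'n) set \<Rightarrow> real^'n" where
  "face_normal K e = (THE \<nu>. norm \<nu> = 1 \<and> (\<forall>x\<in>e. \<forall>y\<in>K. \<nu> \<bullet> (y - x) \<le> 0))"

text \<open>
  The surface measure on a flat face \<open>e\<close>: the area of \<open>A \<subseteq> e\<close> is the volume of the right prism of
  height 1 with mid-section \<open>A\<close>.  The prism over \<open>e\<close> is pushed forward to \<open>e\<close> by the orthogonal
  projection onto the affine hull of \<open>e\<close>.
\<close>

definition surface_measure :: "(real^'n) set \<Rightarrow> (real^'n) measure" where
  "surface_measure e =
     (let \<pi> = closest_point (affine hull e)
      in distr (restrict_space lborel {y. \<pi> y \<in> e \<and> dist y (\<pi> y) \<le> 1/2})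
           (restrict_space borel e) \<pi>)"


section \<open>Discrete spaces\<close>

text \<open>
  A broken function is a family indexed by the elements, \<open>v K\<close> being its restriction to \<open>K\<close>
  (with its trace on the boundary of \<open>K\<close>); only the values of \<open>v K\<close> on \<open>K\<close> matter.  Likewise a
  function on the skeleton is a family indexed by the faces, hence single valued on each face.
\<close>

type_synonym ('n, 'b) broken = "(real^'n) set \<Rightarrow> real^'n \<Rightarrow> 'b"

text \<open>
  Restrictions to \<open>S\<close> of polynomials of total degree at most \<open>k\<close>.  If \<open>S\<close> is a face this is the space
  of polynomials of degree at most \<open>k\<close> in affine coordinates of its hyperplane.
\<close>

definition poly_space :: "nat \<Rightarrow> (real^'n) set \<Rightarrow> (real^'n \<Rightarrow> real) set" where
  "poly_space k S =
     {f. \<exists>a. \<forall>x\<in>S. f x = (\<Sum>\<alpha> | (\<Sum>i\<in>UNIV. \<alpha> i) \<le> k. a \<alpha> * (\<Prod>i\<in>UNIV. (x $ i) ^ \<alpha> i))}"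

definition RT_space :: "nat \<Rightarrow> (real^'n) set \<Rightarrow> (real^'n \<Rightarrow> real^'n) set" where
  "RT_space k K =
     {\<tau>. \<exists>a b. (\<forall>i. a i \<in> poly_space k K) \<and> b \<in> poly_space k K \<and>
             (\<forall>x\<in>K. \<tau> x = (\<chi> i. a i x) + b x *\<^sub>R x)}"

definition Lambda_h :: "nat \<Rightarrow> (real^'n) set set \<Rightarrow> ('n, real) broken set" where
  "Lambda_h k \<T> = {v. \<forall>K\<in>\<T>. v K \<in> poly_space k K}"

definition Theta_h :: "nat \<Rightarrow> (real^'n) set set \<Rightarrow> ('n, real^'n) broken set" where
  "Theta_h k \<T> = {\<tau>. \<forall>K\<in>\<T>. \<tau> K \<in> RT_space k K}"

definition Sigma_h :: "nat \<Rightarrow> (real^'n) set set \<Rightarrow> ('n, real) broken set" where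
  "Sigma_h k \<T> = {m. \<forall>e\<in>mesh_faces \<T>. m e \<in> poly_space k e}"


section \<open>Forms\<close>

definition vol_inner ::
  "(real^'n) set set \<Rightarrow> ('n, 'b::real_inner) broken \<Rightarrow> ('n, 'b) broken \<Rightarrow> real" where
  "vol_inner \<T> f g = (\<Sum>K\<in>\<T>. integral\<^sup>L (lebesgue_on K) (\<lambda>x. f K x \<bullet> g K x))"

text \<open>
  The integrands on the skeleton depend on the element \<open>K\<close>, the face \<open>e\<close> of \<open>K\<close> and the point; a
  face shared by two elements is visited once from each side.
\<close>

definition bdry_inner ::
  "(real^'n) set set \<Rightarrow> ((real^'n) set \<Rightarrow> ('n, real) broken)
     \<Rightarrow> ((real^'n) set \<Rightarrow> ('n, real) broken) \<Rightarrow> real" where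
  "bdry_inner \<T> f g =
     (\<Sum>K\<in>\<T>. \<Sum>e | e facet_of K. integral\<^sup>L (surface_measure e) (\<lambda>x. f K e x * g K e x))"

definition resistance :: "(real \<Rightarrow> real) \<Rightarrow> (real^'n \<Rightarrow> real) \<Rightarrow> real^'n \<Rightarrow> real \<Rightarrow> real" where
  "resistance visc perm x s = visc s / perm x"

text \<open>For \<open>w = 0\<close> the value of \<open>E(w)\<close> is immaterial, because it is multiplied by \<open>norm w\<close>.\<close>

definition dispersion :: "real \<Rightarrow> real \<Rightarrow> real \<Rightarrow> real \<Rightarrow> real^'n \<Rightarrow> real^'n^'n" where
  "dispersion d\<^sub>m d\<^sub>l d\<^sub>t \<phi> w =
     (let E = (\<chi> i j. w $ i * w $ j / (norm w)\<^sup>2)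
      in \<phi> *\<^sub>R (d\<^sub>m *\<^sub>R mat 1 + norm w *\<^sub>R (d\<^sub>l *\<^sub>R E + d\<^sub>t *\<^sub>R (mat 1 - E))))"

text \<open>The concentration of the source; where \<open>q = 0\<close> it only occurs multiplied by \<open>q\<close>.\<close>

definition source_conc :: "real \<Rightarrow> real \<Rightarrow> real \<Rightarrow> real" where
  "source_conc q c_in c = (if q > 0 then c_in else c)"

definition upwind :: "real \<Rightarrow> real \<Rightarrow> real \<Rightarrow> real" where
  "upwind wn c lamc = (if wn > 0 then c else lamc)"

definition B_u ::
  "(real^'n) set set \<Rightarrow> (real \<Rightarrow> real) \<Rightarrow> (real^'n \<Rightarrow> real) \<Rightarrow> ('n, real) broken
     \<Rightarrow> ('n, real^'n) broken \<times> ('n, real) broken \<times> ('n, real) broken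
     \<Rightarrow> ('n, real^'n) broken \<times> ('n, real) broken \<times> ('n, real) broken \<Rightarrow> real" where
  "B_u \<T> visc perm c' = (\<lambda>(u, p, lam) (\<tau>, v, m).
       vol_inner \<T> (\<lambda>K x. resistance visc perm x (c' K x) *\<^sub>R u K x) \<tau>
     + vol_inner \<T> (\<lambda>K. grad K (p K)) \<tau>
     + vol_inner \<T> u (\<lambda>K. grad K (v K))
     + bdry_inner \<T> (\<lambda>K e x. lam e x - p K x) (\<lambda>K e x. \<tau> K x \<bullet> face_normal K e)
     + bdry_inner \<T> (\<lambda>K e x. u K x \<bullet> face_normal K e) (\<lambda>K e x. m e x - v K x))"

definition B_c ::
  "(real^'n) set set \<Rightarrow> real \<Rightarrow> (real^'n \<Rightarrow> real) \<Rightarrow> real \<Rightarrow> real \<Rightarrow> real \<Rightarrow> ('n, real^'n) broken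
     \<Rightarrow> ('n, real^'n) broken \<times> ('n, real) broken \<times> ('n, real) broken
     \<Rightarrow> ('n, real^'n) broken \<times> ('n, real) broken \<times> ('n, real) broken \<Rightarrow> real" where
  "B_c \<T> \<Delta>t poro d\<^sub>m d\<^sub>l d\<^sub>t w = (\<lambda>(\<sigma>, c, lamc) (\<tau>, v, m).
     - (1 / \<Delta>t) * vol_inner \<T> (\<lambda>K x. poro x * c K x) v
     + vol_inner \<T> (\<lambda>K x. \<sigma> K x + c K x *\<^sub>R w K x) (\<lambda>K. grad K (v K))
     + vol_inner \<T> (\<lambda>K x. matrix_inv (dispersion d\<^sub>m d\<^sub>l d\<^sub>t (poro x) (w K x)) *v \<sigma> K x
                          + grad K (c K) x) \<tau>
     + bdry_inner \<T> (\<lambda>K e x. lamc e x - c K x) (\<lambda>K e x. \<tau> K x \<bullet> face_normal K e)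
     + bdry_inner \<T>
         (\<lambda>K e x. \<sigma> K x \<bullet> face_normal K e
                  + (w K x \<bullet> face_normal K e) * upwind (w K x \<bullet> face_normal K e) (c K x) (lamc e x))
         (\<lambda>K e x. m e x - v K x))"


section \<open>The miscible displacement problem\<close>

definition admissible_coefficients ::
  "(real^'n) set \<Rightarrow> (real^'n \<Rightarrow> real) \<Rightarrow> (real^'n \<Rightarrow> real) \<Rightarrow> (real \<Rightarrow> real) \<Rightarrow> bool" where
  "admissible_coefficients \<Omega> perm poro visc \<longleftrightarrow>
     perm \<in> borel_measurable (lebesgue_on \<Omega>) \<and> poro \<in> borel_measurable (lebesgue_on \<Omega>) \<and>
     (\<exists>l>0. \<exists>b. \<forall>x\<in>\<Omega>. l \<le> perm x \<and> perm x \<le> b \<and> l \<le> poro x \<and> poro x \<le> b) \<and>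
     continuous_on UNIV visc \<and> (\<forall>s. visc s > 0)"

definition diffusive_flux ::
  "(real^'n) set \<Rightarrow> (real^'n \<Rightarrow> real) \<Rightarrow> real \<Rightarrow> real \<Rightarrow> real
     \<Rightarrow> (real^'n \<Rightarrow> real^'n) \<Rightarrow> (real^'n \<Rightarrow> real) \<Rightarrow> real^'n \<Rightarrow> real^'n" where
  "diffusive_flux \<Omega> poro d\<^sub>m d\<^sub>l d\<^sub>t u c x =
     - (dispersion d\<^sub>m d\<^sub>l d\<^sub>t (poro x) (u x) *v grad (closure \<Omega>) c x)"

text \<open>
  The equations and boundary conditions at one instant, in classical form.  All arguments from \<open>q\<close>
  on are functions of \<open>x\<close>.  The concentration \<open>c'\<close> in the viscosity and the time derivative \<open>c_t\<close>
  are separate arguments: for the problem itself they are \<open>c\<close> and \<open>\<partial>\<^sub>t c\<close>, for the problem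
  discretized in time they are the previous concentration and the backward difference quotient.
\<close>

definition mdp_equations ::
  "(real^'n) set \<Rightarrow> (real^'n \<Rightarrow> real) \<Rightarrow> (real^'n \<Rightarrow> real) \<Rightarrow> (real \<Rightarrow> real) \<Rightarrow> real \<Rightarrow> real \<Rightarrow> real
     \<Rightarrow> (real^'n \<Rightarrow> real) \<Rightarrow> (real^'n \<Rightarrow> real) \<Rightarrow> (real^'n \<Rightarrow> real) \<Rightarrow> (real^'n \<Rightarrow> real)
     \<Rightarrow> (real^'n \<Rightarrow> real^'n) \<Rightarrow> (real^'n \<Rightarrow> real) \<Rightarrow> (real^'n \<Rightarrow> real) \<Rightarrow> bool" where
  "mdp_equations \<Omega> perm poro visc d\<^sub>m d\<^sub>l d\<^sub>t q c_in c' c_t u p c \<longleftrightarrow>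
     C1_on (closure \<Omega>) u \<and> C1_on (closure \<Omega>) p \<and> C1_on (closure \<Omega>) c \<and>
     C1_on (closure \<Omega>) (diffusive_flux \<Omega> poro d\<^sub>m d\<^sub>l d\<^sub>t u c) \<and>
     continuous_on (closure \<Omega>) c_t \<and>
     (\<forall>x\<in>\<Omega>. divg (closure \<Omega>) u x = q x) \<and>
     (\<forall>x\<in>\<Omega>. u x = - (perm x / visc (c' x)) *\<^sub>R grad (closure \<Omega>) p x) \<and>
     (\<forall>x\<in>\<Omega>. poro x * c_t x
          + divg (closure \<Omega>) (\<lambda>y. c y *\<^sub>R u y + diffusive_flux \<Omega> poro d\<^sub>m d\<^sub>l d\<^sub>t u c y) x
          = q x * source_conc (q x) (c_in x) (c x)) \<and>
     (\<forall>x\<in>frontier \<Omega>. \<forall>\<nu>. domain_normal \<Omega> x \<nu> \<longrightarrow>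
          u x \<bullet> \<nu> = 0 \<and>
          (dispersion d\<^sub>m d\<^sub>l d\<^sub>t (poro x) (u x) *v grad (closure \<Omega>) c x) \<bullet> \<nu> = 0)"

definition time_deriv :: "real \<Rightarrow> (real \<Rightarrow> real^'n \<Rightarrow> real) \<Rightarrow> real \<Rightarrow> real^'n \<Rightarrow> real" where
  "time_deriv T c t x = vector_derivative (\<lambda>s. c s x) (at t within {0..T})"

text \<open>
  Functions of time and space take the time first, so that \<open>w\<^sup>n\<close> is \<open>w (time_level T M n)\<close>.
\<close>

definition mdp_solution ::
  "(real^'n) set \<Rightarrow> real \<Rightarrow> (real^'n \<Rightarrow> real) \<Rightarrow> (real^'n \<Rightarrow> real) \<Rightarrow> (real \<Rightarrow> real)
     \<Rightarrow> real \<Rightarrow> real \<Rightarrow> real \<Rightarrow> (real \<Rightarrow> real^'n \<Rightarrow> real) \<Rightarrow> (real \<Rightarrow> real^'n \<Rightarrow> real) \<Rightarrow> (real^'n \<Rightarrow> real)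
     \<Rightarrow> (real \<Rightarrow> real^'n \<Rightarrow> real^'n) \<Rightarrow> (real \<Rightarrow> real^'n \<Rightarrow> real) \<Rightarrow> (real \<Rightarrow> real^'n \<Rightarrow> real) \<Rightarrow> bool"
where
  "mdp_solution \<Omega> T perm poro visc d\<^sub>m d\<^sub>l d\<^sub>t q c_in c0 u p c \<longleftrightarrow>
     (\<forall>x\<in>\<Omega>. c 0 x = c0 x) \<and>
     (\<forall>t\<in>{0..T}. continuous_on (closure \<Omega>) (c t)) \<and>
     (\<forall>t\<in>{0<..T}.
        (\<forall>x\<in>closure \<Omega>. (\<lambda>s. c s x) differentiable (at t within {0..T})) \<and>
        mdp_equations \<Omega> perm poro visc d\<^sub>m d\<^sub>l d\<^sub>t (q t) (c_in t)
          (c t) (time_deriv T c t) (u t) (p t) (c t))"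

definition time_step :: "real \<Rightarrow> nat \<Rightarrow> real" where
  "time_step T M = T / real M"

definition time_level :: "real \<Rightarrow> nat \<Rightarrow> nat \<Rightarrow> real" where
  "time_level T M n = real n * time_step T M"

text \<open>
  The problem discretized in time only, with the time stepping of the algorithm: backward
  difference quotient for \<open>\<partial>\<^sub>t c\<close>, viscosity at the previous time level.  Only the values at the
  time levels are involved.
\<close>

definition mdp_time_discrete_solution ::
  "(real^'n) set \<Rightarrow> real \<Rightarrow> nat \<Rightarrow> (real^'n \<Rightarrow> real) \<Rightarrow> (real^'n \<Rightarrow> real) \<Rightarrow> (real \<Rightarrow> real)
     \<Rightarrow> real \<Rightarrow> real \<Rightarrow> real \<Rightarrow> (real \<Rightarrow> real^'n \<Rightarrow> real) \<Rightarrow> (real \<Rightarrow> real^'n \<Rightarrow> real) \<Rightarrow> (real^'n \<Rightarrow> real)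
     \<Rightarrow> (real \<Rightarrow> real^'n \<Rightarrow> real^'n) \<Rightarrow> (real \<Rightarrow> real^'n \<Rightarrow> real) \<Rightarrow> (real \<Rightarrow> real^'n \<Rightarrow> real) \<Rightarrow> bool"
where
  "mdp_time_discrete_solution \<Omega> T M perm poro visc d\<^sub>m d\<^sub>l d\<^sub>t q c_in c0 u p c \<longleftrightarrow>
     (\<forall>x\<in>\<Omega>. c 0 x = c0 x) \<and>
     continuous_on (closure \<Omega>) (c 0) \<and>
     (\<forall>n\<in>{1..M}.
        let t = time_level T M n; t' = time_level T M (n - 1)
        in mdp_equations \<Omega> perm poro visc d\<^sub>m d\<^sub>l d\<^sub>t (q t) (c_in t)
             (c t') (\<lambda>x. (c t x - c t' x) / time_step T M) (u t) (p t) (c t))"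

end

theory Submission
  imports Defs
begin

text \<open>
  Consistency is proved by integrating the differential equations by parts on each element and by
  showing that the contributions of the faces cancel.  Let \<open>F\<close> be one of the two conserved fluxes:
  the Darcy velocity \<open>u\<close>, or the total flux \<open>c u - D(u) \<nabla>c\<close>.  Green's formula on an element \<open>K\<close>,
  \<open>\<integral>\<^sub>K F \<cdot> \<nabla>v + \<integral>\<^sub>K v div F = \<Sum>\<^sub>e \<integral>\<^sub>e v F \<cdot> n\<close> with the sum over the faces of \<open>K\<close>, collapses the terms with \<open>v\<close>
  in the discrete form to \<open>-(div F, v)\<close>, which the differential equation evaluates.  What
  remains is \<open>\<langle>F \<cdot> n, m\<rangle>\<close> with a single valued \<open>m\<close>: a face between two elements is
  visited twice with opposite normals, and on a face in the boundary of the domain the normal flux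
  vanishes by the boundary condition.  The traces \<open>\<lambda>\<close> and \<open>\<lambda>\<^sup>c\<close> are the exact pressure
  and concentration, so \<open>\<langle>\<lambda> - p, \<tau> \<cdot> n\<rangle>\<close> and \<open>\<langle>\<lambda>\<^sup>c - c, \<tau> \<cdot> n\<rangle>\<close> vanish and both branches of the upwind
  value agree.  The constitutive laws hold at every point of the domain, so the remaining terms with
  \<open>\<tau>\<close> cancel.  For the problem that is continuous in time, two residuals are left: the viscosity is
  evaluated at the previous time level, and the time derivative is replaced by a difference quotient.

  The analytic core is the formula \<open>\<integral>\<^sub>K \<partial>\<^sub>h g = \<Sum>\<^sub>e (n\<^sub>e \<cdot> h) \<integral>\<^sub>e g\<close> on a simplex, with \<open>\<integral>\<^sub>e\<close> taken for the
  surface measure that is defined through prisms (\<open>simplex_derivative_integral\<close>).  It suffices to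
  prove it for the edge vectors \<open>h = b - a\<close>, since they span.  In barycentric coordinates, motion
  along \<open>h\<close> increases the coordinate of \<open>b\<close>, decreases that of \<open>a\<close> at the same rate and fixes all the
  others.  Hence every line parallel to \<open>h\<close> that meets \<open>K\<close> enters through the facet opposite \<open>b\<close> and
  leaves through the facet opposite \<open>a\<close>, and the fundamental theorem of calculus on these lines gives
  the difference of the values at exit and entry on every such line, without exception.  To sum over
  the lines without choosing coordinates, \<open>lborel_line_slicing\<close> writes Lebesgue measure as the
  image of a unit slab times \<open>\<real>\<close>.  The same slicing shows that the oblique prisms that arise in this
  way have the volume predicted by the right prism in the definition of the surface measure.

  Two geometric facts enter the cancellation (\<open>normal_flux_cancels\<close>).  Near a relative interior point
  of a facet, a simplex is a half ball (\<open>simplex_half_ball\<close>); hence two elements on the same side of a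
  common facet would overlap, and a facet of only one element lies in the boundary of the domain with
  the normal of the element as outward normal.  Points on the relative boundary of a facet are
  reached by continuity of the flux.
\<close>

section \<open>Lebesgue measure along parallel lines\<close>

text \<open>
  A point \<open>x\<close> is reached from the slab along \<open>h\<close> exactly for the parameters \<open>s\<close> with
  \<open>0 \<le> l x - s \<le> 1\<close>, a set of length 1; so by Tonelli and translation invariance the map
  \<open>(y, s) \<mapsto> y + s h\<close> counts every volume once.
\<close>

lemma lborel_line_slicing:
  fixes h :: "'a::euclidean_space" and l :: "'a \<Rightarrow> real"
  assumes l_meas [measurable]: "l \<in> borel_measurable borel"
    and l: "\<And>y s. l (y + s *\<^sub>R h) = l y + s"
  shows "distr (density (lborel \<Otimes>\<^sub>M lborel) (\<lambda>(y, s). indicator {y. 0 \<le> l y \<and> l y \<le> 1} y))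
           lborel (\<lambda>(y, s). y + s *\<^sub>R h) = lborel" (is "distr ?D _ ?\<phi> = _")
proof (rule measure_eqI)
  let ?W = "{y. 0 \<le> l y \<and> l y \<le> 1}"
  have W [measurable]: "?W \<in> sets borel"
    by measurable
  have \<phi> [measurable]: "?\<phi> \<in> ?D \<rightarrow>\<^sub>M lborel"
    by simp
  fix A :: "'a set" assume "A \<in> sets (distr ?D lborel ?\<phi>)"
  then have A [measurable]: "A \<in> sets borel" by simp
  have shift: "(\<integral>\<^sup>+y. indicator ?W y * indicator A (y + s *\<^sub>R h) \<partial>lborel)
             = (\<integral>\<^sup>+x. indicator ?W (x - s *\<^sub>R h) * indicator A x \<partial>lborel)" for s
  proof -
    have "(\<integral>\<^sup>+x. indicator ?W (x - s *\<^sub>R h) * indicator A x \<partial>lborel)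
        = (\<integral>\<^sup>+x. indicator ?W (x - s *\<^sub>R h) * indicator A x \<partial>distr lborel borel ((+) (s *\<^sub>R h)))"
      by (simp only: lborel_distr_plus)
    also have "\<dots> = (\<integral>\<^sup>+y. indicator ?W y * indicator A (y + s *\<^sub>R h) \<partial>lborel)"
      by (subst nn_integral_distr) (auto simp: algebra_simps)
    finally show ?thesis by simp
  qed
  have one: "(\<integral>\<^sup>+s. indicator ?W (x - s *\<^sub>R h) \<partial>lborel) = 1" for x
  proof -
    have "l (x - s *\<^sub>R h) = l x - s" for s
      using l[of x "- s"] by simp
    then have "(\<lambda>s. indicator ?W (x - s *\<^sub>R h) :: ennreal) = indicator {l x - 1 .. l x}"
      by (auto simp: fun_eq_iff indicator_def)
    then show ?thesis by simp
  qed
  have "emeasure (distr ?D lborel ?\<phi>) A = (\<integral>\<^sup>+z. indicator A z \<partial>distr ?D lborel ?\<phi>)"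
    by simp
  also have "\<dots> = (\<integral>\<^sup>+z. indicator A (?\<phi> z) \<partial>?D)"
    by (rule nn_integral_distr) auto
  also have "\<dots> = (\<integral>\<^sup>+z. (case z of (y, s) \<Rightarrow> indicator ?W y) * indicator A (?\<phi> z) \<partial>(lborel \<Otimes>\<^sub>M lborel))"
    by (rule nn_integral_density) auto
  also have "\<dots> = (\<integral>\<^sup>+s. \<integral>\<^sup>+y. indicator ?W y * indicator A (y + s *\<^sub>R h) \<partial>lborel \<partial>lborel)"
    by (subst lborel_pair.nn_integral_snd[symmetric]) auto
  also have "\<dots> = (\<integral>\<^sup>+s. \<integral>\<^sup>+x. indicator ?W (x - s *\<^sub>R h) * indicator A x \<partial>lborel \<partial>lborel)"
    by (simp only: shift)
  also have "\<dots> = (\<integral>\<^sup>+x. \<integral>\<^sup>+s. indicator ?W (x - s *\<^sub>R h) * indicator A x \<partial>lborel \<partial>lborel)"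
    by (rule lborel_pair.Fubini') measurable
  also have "\<dots> = (\<integral>\<^sup>+x. indicator A x \<partial>lborel)"
    by (subst nn_integral_multc) (auto simp: one)
  finally show "emeasure (distr ?D lborel ?\<phi>) A = emeasure lborel A" by simp
qed simp

lemma nn_integral_line_slicing:
  fixes h :: "'a::euclidean_space" and l :: "'a \<Rightarrow> real" and f :: "'a \<Rightarrow> ennreal"
  assumes l_meas [measurable]: "l \<in> borel_measurable borel"
    and l: "\<And>y s. l (y + s *\<^sub>R h) = l y + s"
    and [measurable]: "f \<in> borel_measurable borel"
  shows "(\<integral>\<^sup>+z. f z \<partial>lborel)
       = (\<integral>\<^sup>+y. indicator {y. 0 \<le> l y \<and> l y \<le> 1} y * (\<integral>\<^sup>+s. f (y + s *\<^sub>R h) \<partial>lborel) \<partial>lborel)"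
proof -
  let ?W = "{y. 0 \<le> l y \<and> l y \<le> 1}"
  have "(\<integral>\<^sup>+z. f z \<partial>lborel) = (\<integral>\<^sup>+z. f z \<partial>distr (density (lborel \<Otimes>\<^sub>M lborel) (\<lambda>(y, s). indicator ?W y))
       lborel (\<lambda>(y, s). y + s *\<^sub>R h))"
    by (simp only: lborel_line_slicing[OF l_meas l])
  also have "\<dots> = (\<integral>\<^sup>+z. f (case z of (y, s) \<Rightarrow> y + s *\<^sub>R h)
       \<partial>density (lborel \<Otimes>\<^sub>M lborel) (\<lambda>(y, s). indicator ?W y))"
    by (rule nn_integral_distr) auto
  also have "\<dots> = (\<integral>\<^sup>+z. (case z of (y, s) \<Rightarrow> indicator ?W y) * f (case z of (y, s) \<Rightarrow> y + s *\<^sub>R h)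
       \<partial>(lborel \<Otimes>\<^sub>M lborel))"
    by (rule nn_integral_density) auto
  also have "\<dots> = (\<integral>\<^sup>+y. \<integral>\<^sup>+s. indicator ?W y * f (y + s *\<^sub>R h) \<partial>lborel \<partial>lborel)"
    by (subst lborel.nn_integral_fst[symmetric]) auto
  finally show ?thesis by (simp add: nn_integral_cmult)
qed

lemma integral_line_slicing:
  fixes h :: "'a::euclidean_space" and l f :: "'a \<Rightarrow> real"
  assumes l_meas [measurable]: "l \<in> borel_measurable borel"
    and l: "\<And>y s. l (y + s *\<^sub>R h) = l y + s"
    and f: "integrable lborel f"
  shows "has_bochner_integral lborel
           (\<lambda>y. indicator {y. 0 \<le> l y \<and> l y \<le> 1} y * (\<integral>s. f (y + s *\<^sub>R h) \<partial>lborel)) (\<integral>y. f y \<partial>lborel)"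
proof -
  let ?w = "\<lambda>y. indicator {y. 0 \<le> l y \<and> l y \<le> 1} y :: real"
  let ?wn = "\<lambda>(y, s :: real). indicator {y. 0 \<le> l y \<and> l y \<le> 1} y :: ennreal"
  let ?\<phi> = "\<lambda>(y, s). y + s *\<^sub>R h"
  have [measurable]: "f \<in> borel_measurable borel" using f by simp
  have wn: "?wn = (\<lambda>z. ennreal (?w (fst z)))"
    by (auto simp: fun_eq_iff ennreal_indicator)
  have "integrable (distr (density (lborel \<Otimes>\<^sub>M lborel) ?wn) lborel ?\<phi>) f"
    using f by (simp only: lborel_line_slicing[OF l_meas l])
  then have "integrable (density (lborel \<Otimes>\<^sub>M lborel) ?wn) (\<lambda>z. f (?\<phi> z))"
    by (subst (asm) integrable_distr_eq) auto
  then have int: "integrable (lborel \<Otimes>\<^sub>M lborel) (\<lambda>z. ?w (fst z) *\<^sub>R f (?\<phi> z))"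
    unfolding wn by (subst (asm) integrable_density) auto
  then have int': "integrable (lborel \<Otimes>\<^sub>M lborel) (\<lambda>(y, s). ?w y * f (y + s *\<^sub>R h))"
    by (simp add: case_prod_unfold)
  have "(\<integral>y. f y \<partial>lborel) = (\<integral>y. f y \<partial>distr (density (lborel \<Otimes>\<^sub>M lborel) ?wn) lborel ?\<phi>)"
    by (simp only: lborel_line_slicing[OF l_meas l])
  also have "\<dots> = (\<integral>z. f (?\<phi> z) \<partial>density (lborel \<Otimes>\<^sub>M lborel) ?wn)"
    by (rule integral_distr) auto
  also have "\<dots> = (\<integral>z. ?w (fst z) *\<^sub>R f (?\<phi> z) \<partial>(lborel \<Otimes>\<^sub>M lborel))"
    unfolding wn by (rule integral_density) auto
  also have "\<dots> = (\<integral>(y, s). ?w y * f (y + s *\<^sub>R h) \<partial>(lborel \<Otimes>\<^sub>M lborel))"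
    by (simp add: case_prod_unfold)
  also have "\<dots> = (\<integral>y. \<integral>s. ?w y * f (y + s *\<^sub>R h) \<partial>lborel \<partial>lborel)"
    using lborel_pair.integral_fst[OF int'] by simp
  finally have "(\<integral>y. f y \<partial>lborel) = (\<integral>y. ?w y * (\<integral>s. f (y + s *\<^sub>R h) \<partial>lborel) \<partial>lborel)"
    by simp
  moreover have "integrable lborel (\<lambda>y. ?w y * (\<integral>s. f (y + s *\<^sub>R h) \<partial>lborel))"
    using lborel_pair.integrable_fst[OF int'] by simp
  ultimately show ?thesis by (simp add: has_bochner_integral_iff)
qed

text \<open>
  On each line parallel to \<open>k\<close> the shear is a translation, because \<open>N \<bullet> y\<close> is constant there; slicing
  along \<open>k\<close> therefore reduces the claim to translation invariance on the real line.
\<close>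

lemma lborel_distr_shear:
  fixes N k :: "'a::euclidean_space"
  assumes "N \<bullet> k = 0"
  shows "distr lborel lborel (\<lambda>y. y + (N \<bullet> y + b) *\<^sub>R k) = lborel"
proof (cases "k = 0")
  case True
  then show ?thesis by (simp add: distr_id2)
next
  case False
  let ?l = "\<lambda>y. (k \<bullet> y) / (k \<bullet> k)"
  let ?W = "{y. 0 \<le> ?l y \<and> ?l y \<le> 1}"
  have l: "?l (y + s *\<^sub>R k) = ?l y + s" for y s
    using False by (simp add: inner_right_distrib add_divide_distrib)
  have l': "?l \<in> borel_measurable borel" by measurable
  show ?thesis
  proof (rule measure_eqI)
    fix A :: "'a set" assume "A \<in> sets (distr lborel lborel (\<lambda>y. y + (N \<bullet> y + b) *\<^sub>R k))"
    then have A [measurable]: "A \<in> sets borel" by simp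
    have line: "(\<integral>\<^sup>+s. indicator A (y + s *\<^sub>R k + (N \<bullet> (y + s *\<^sub>R k) + b) *\<^sub>R k) \<partial>lborel)
              = (\<integral>\<^sup>+s. indicator A (y + s *\<^sub>R k) \<partial>lborel)" for y
      using \<open>N \<bullet> k = 0\<close>
        nn_integral_real_affine[where f="\<lambda>s. indicator A (y + s *\<^sub>R k)" and c=1 and t="N \<bullet> y + b"]
      by (simp add: inner_right_distrib algebra_simps)
    have "emeasure (distr lborel lborel (\<lambda>y. y + (N \<bullet> y + b) *\<^sub>R k)) A
        = (\<integral>\<^sup>+y. indicator A (y + (N \<bullet> y + b) *\<^sub>R k) \<partial>lborel)"
      by (subst nn_integral_indicator[symmetric], simp, subst nn_integral_distr) auto
    also have "\<dots> = (\<integral>\<^sup>+y. indicator A y \<partial>lborel)"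
      by (subst (1 2) nn_integral_line_slicing[OF l' l]) (auto simp: line)
    finally show "emeasure (distr lborel lborel (\<lambda>y. y + (N \<bullet> y + b) *\<^sub>R k)) A = emeasure lborel A"
      by simp
  qed simp
qed

section \<open>Barycentric coordinates\<close>

text \<open>
  The vertices other than \<open>a\<close> span a hyperplane that does not contain \<open>a\<close>; its equation, scaled to take
  the value 1 at \<open>a\<close>, is the barycentric coordinate belonging to \<open>a\<close>.
\<close>

lemma affine_functionals_of_simplex_vertices:
  fixes C :: "'a::euclidean_space set"
  assumes indep: "\<not> affine_dependent C" and card: "card C = DIM('a) + 1"
  obtains N \<beta> where "\<And>a c. a \<in> C \<Longrightarrow> c \<in> C \<Longrightarrow> N a \<bullet> c + \<beta> a = (if c = a then 1 else 0)"
proof -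
  have fin: "finite C" using indep by (rule aff_independent_finite)
  have "\<exists>N \<beta>. \<forall>c\<in>C. N \<bullet> c + \<beta> = (if c = a then 1 else 0)" if a: "a \<in> C" for a
  proof -
    have "\<not> affine_dependent (C - {a})"
      using indep by (rule affine_independent_Diff)
    from aff_dim_affine_independent[OF this]
    have "aff_dim (C - {a}) = DIM('a) - 1"
      using card a fin by simp
    then obtain n b where "n \<noteq> 0" and hyp: "affine hull (C - {a}) = {x. n \<bullet> x = b}"
      unfolding aff_dim_eq_hyperplane by blast
    have "a \<notin> affine hull (C - {a})"
      using indep a by (auto simp: affine_dependent_def)
    then have na: "n \<bullet> a \<noteq> b" using hyp by blast
    have "(n /\<^sub>R (n \<bullet> a - b)) \<bullet> c + - b / (n \<bullet> a - b) = (if c = a then 1 else 0)" if "c \<in> C" for c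
    proof -
      have "(n /\<^sub>R (n \<bullet> a - b)) \<bullet> c + - b / (n \<bullet> a - b) = (n \<bullet> c - b) / (n \<bullet> a - b)"
        by (simp add: divide_inverse algebra_simps)
      moreover have "n \<bullet> c = b" if "c \<noteq> a"
      proof -
        have "c \<in> affine hull (C - {a})" using that \<open>c \<in> C\<close> by (simp add: hull_inc)
        then show ?thesis using hyp by blast
      qed
      ultimately show ?thesis using na by auto
    qed
    then show ?thesis by blast
  qed
  then show ?thesis using that by metis
qed

text \<open>
  The vertices \<open>C\<close> of a simplex of full dimension together with the gradients \<open>N a\<close> and constants
  \<open>\<beta> a\<close> of its barycentric coordinates.
\<close>

locale simplex_coords =
  fixes C :: "(real^'n) set" and N :: "real^'n \<Rightarrow> real^'n" and \<beta> :: "real^'n \<Rightarrow> real"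
  assumes indep: "\<not> affine_dependent C" and card_C: "card C = CARD('n) + 1"
    and dual: "\<And>a c. a \<in> C \<Longrightarrow> c \<in> C \<Longrightarrow> N a \<bullet> c + \<beta> a = (if c = a then 1 else 0)"
begin

definition bary :: "real^'n \<Rightarrow> real^'n \<Rightarrow> real" where
  "bary a x = N a \<bullet> x + \<beta> a"

definition facet :: "real^'n \<Rightarrow> (real^'n) set" where
  "facet a = convex hull (C - {a})"

lemma finite_C: "finite C"
  using indep by (rule aff_independent_finite)

lemma bary_shift: "bary a (x + s *\<^sub>R h) = bary a x + s * (N a \<bullet> h)"
  by (simp add: bary_def inner_right_distrib)

lemma bary_diff: "N a \<bullet> (x - y) = bary a x - bary a y"
  by (simp add: bary_def inner_diff_right)

lemma bary_vertex: "a \<in> C \<Longrightarrow> c \<in> C \<Longrightarrow> bary a c = (if c = a then 1 else 0)"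
  unfolding bary_def by (rule dual)

lemma continuous_bary: "continuous_on S (bary a)"
  unfolding bary_def by (intro continuous_intros)

lemma bary_combination:
  assumes a: "a \<in> C" and u: "sum u C = 1"
  shows "bary a (\<Sum>c\<in>C. u c *\<^sub>R c) = u a"
proof -
  have "bary a (\<Sum>c\<in>C. u c *\<^sub>R c) = (\<Sum>c\<in>C. u c * (N a \<bullet> c)) + (\<Sum>c\<in>C. u c) * \<beta> a"
    by (simp add: bary_def inner_sum_right u)
  also have "\<dots> = (\<Sum>c\<in>C. u c * (N a \<bullet> c + \<beta> a))"
    by (simp add: sum_distrib_right sum.distrib ring_distribs)
  also have "\<dots> = (\<Sum>c\<in>C. if c = a then u c else 0)"
    by (rule sum.cong) (auto simp: dual a)
  finally show ?thesis using a finite_C by simp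
qed

lemma affine_hull_C: "affine hull C = UNIV"
  using aff_dim_affine_independent[OF indep] card_C aff_dim_eq_full[of C] by simp

lemma bary_representation:
  shows "(\<Sum>a\<in>C. bary a x) = 1" and "(\<Sum>a\<in>C. bary a x *\<^sub>R a) = x"
proof -
  have "x \<in> affine hull C" by (simp add: affine_hull_C)
  then obtain u where u: "sum u C = 1" and x: "(\<Sum>c\<in>C. u c *\<^sub>R c) = x"
    unfolding affine_hull_finite[OF finite_C] by blast
  have "bary a x = u a" if "a \<in> C" for a
    using bary_combination[OF that u] x by simp
  then show "(\<Sum>a\<in>C. bary a x) = 1" "(\<Sum>a\<in>C. bary a x *\<^sub>R a) = x"
    using u x by auto
qed

lemma mem_simplex_iff: "x \<in> convex hull C \<longleftrightarrow> (\<forall>a\<in>C. 0 \<le> bary a x)"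
proof
  assume "x \<in> convex hull C"
  then show "\<forall>a\<in>C. 0 \<le> bary a x"
    unfolding convex_hull_finite[OF finite_C] by (auto simp: bary_combination)
next
  assume "\<forall>a\<in>C. 0 \<le> bary a x"
  then show "x \<in> convex hull C"
    unfolding convex_hull_finite[OF finite_C] using bary_representation by auto
qed

lemma mem_facet_iff:
  assumes a: "a \<in> C"
  shows "x \<in> facet a \<longleftrightarrow> x \<in> convex hull C \<and> bary a x = 0"
proof
  assume x: "x \<in> facet a"
  then obtain u where u: "\<forall>c\<in>C - {a}. 0 \<le> u c" "sum u (C - {a}) = 1"
      "(\<Sum>c\<in>C - {a}. u c *\<^sub>R c) = x"
    unfolding facet_def using finite_C by (subst (asm) convex_hull_finite) auto
  define v where "v = u(a := 0)"
  have v: "sum v C = 1" "(\<Sum>c\<in>C. v c *\<^sub>R c) = x"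
    using u(2,3) a finite_C by (auto simp: v_def sum.remove)
  have "bary a x = 0"
    using bary_combination[OF a v(1)] v(2) by (simp add: v_def)
  moreover have "x \<in> convex hull C"
    using x hull_mono[of "C - {a}" C] by (auto simp: facet_def)
  ultimately show "x \<in> convex hull C \<and> bary a x = 0" by blast
next
  assume x: "x \<in> convex hull C \<and> bary a x = 0"
  then have "(\<Sum>c\<in>C - {a}. bary c x) = 1" "(\<Sum>c\<in>C - {a}. bary c x *\<^sub>R c) = x"
    using bary_representation[of x] a finite_C by (auto simp: sum.remove)
  then show "x \<in> facet a"
    unfolding facet_def using finite_C x mem_simplex_iff[of x]
    by (subst convex_hull_finite) auto
qed

lemma affine_hull_facet:
  assumes a: "a \<in> C"
  shows "affine hull (facet a) = {x. bary a x = 0}"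
proof -
  have "affine hull (C - {a}) \<subseteq> {x. bary a x = 0}"
  proof (rule hull_minimal)
    show "C - {a} \<subseteq> {x. bary a x = 0}" using a by (auto simp: bary_vertex)
    show "affine {x. bary a x = 0}"
      using affine_hyperplane[of "N a" "- \<beta> a"] by (simp add: bary_def eq_neg_iff_add_eq_0)
  qed
  moreover have "x \<in> affine hull (C - {a})" if "bary a x = 0" for x
  proof -
    have "(\<Sum>c\<in>C - {a}. bary c x) = 1" "(\<Sum>c\<in>C - {a}. bary c x *\<^sub>R c) = x"
      using bary_representation[of x] a finite_C that by (auto simp: sum.remove)
    then show ?thesis
      using finite_C by (subst affine_hull_finite) auto
  qed
  ultimately show ?thesis by (auto simp: facet_def)
qed

lemma other_vertex:
  assumes "a \<in> C"
  obtains b where "b \<in> C" "b \<noteq> a"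
proof -
  have "card (C - {a}) > 0" using card_C assms finite_C by simp
  then obtain b where "b \<in> C - {a}" by (metis card_gt_0_iff ex_in_conv)
  then show ?thesis using that by blast
qed

lemma N_edge: "a \<in> C \<Longrightarrow> b \<in> C \<Longrightarrow> c \<in> C \<Longrightarrow>
    N c \<bullet> (b - a) = (if b = c then 1 else 0) - (if a = c then 1 else 0)"
  by (simp add: bary_diff bary_vertex)

lemma N_nonzero: "a \<in> C \<Longrightarrow> N a \<noteq> 0"
  by (metis other_vertex bary_vertex bary_def inner_zero_left zero_neq_one)

lemma facets: "e facet_of (convex hull C) \<longleftrightarrow> (\<exists>a\<in>C. e = facet a)"
proof -
  have "facet a \<noteq> {}" if "a \<in> C" for a
    using other_vertex[OF that] unfolding facet_def by (metis Diff_iff convex_hull_eq_empty empty_iff singletonD)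
  then show ?thesis
    unfolding facet_of_convex_hull_affine_independent[OF indep] by (auto simp: facet_def)
qed

lemma inj_on_facet: "inj_on facet C"
proof (rule inj_onI)
  fix a b assume ab: "a \<in> C" "b \<in> C" "facet a = facet b"
  show "a = b"
  proof (rule ccontr)
    assume "a \<noteq> b"
    then have "a \<in> facet b" using ab(1) by (auto simp: facet_def hull_inc)
    then have "a \<in> facet a" using ab(3) by simp
    then show False using ab(1) by (simp add: mem_facet_iff bary_vertex)
  qed
qed

text \<open>
  The difference of the two sides is orthogonal to \<open>c - z\<close> for every vertex \<open>c\<close>, and the affine hull of
  the vertices is the whole space.
\<close>

lemma orthogonal_to_facet:
  assumes a: "a \<in> C" and orth: "\<And>x y. x \<in> facet a \<Longrightarrow> y \<in> facet a \<Longrightarrow> \<nu> \<bullet> (y - x) = 0"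
    and z: "z \<in> facet a"
  shows "\<nu> = (\<nu> \<bullet> (a - z)) *\<^sub>R N a"
proof -
  define w where "w = \<nu> - (\<nu> \<bullet> (a - z)) *\<^sub>R N a"
  have bz: "bary a z = 0" using z a by (simp add: mem_facet_iff)
  have "w \<bullet> (c - z) = 0" if c: "c \<in> C" for c
  proof (cases "c = a")
    case True
    then show ?thesis using a bz by (simp add: w_def inner_diff_left bary_diff bary_vertex)
  next
    case False
    then have "c \<in> facet a" using c by (simp add: facet_def hull_inc)
    then show ?thesis using orth[OF z, of c] a bz c False
      by (simp add: w_def inner_diff_left bary_diff bary_vertex)
  qed
  then have "C \<subseteq> {x. w \<bullet> x = w \<bullet> z}" by (auto simp: inner_diff_right)
  then have "affine hull C \<subseteq> {x. w \<bullet> x = w \<bullet> z}"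
    by (intro hull_minimal affine_hyperplane)
  then have "w \<bullet> (z + w) = w \<bullet> z" by (auto simp: affine_hull_C)
  then have "w = 0" by (simp add: inner_right_distrib)
  then show ?thesis by (simp add: w_def)
qed

lemma facet_nonempty: "a \<in> C \<Longrightarrow> facet a \<noteq> {}"
  using facets[of "facet a"] by (auto simp: facet_of_def)

text \<open>
  The barycentric coordinate of the opposite vertex vanishes on the facet and is nonnegative on the
  simplex, so its gradient is an inward normal; \<open>orthogonal_to_facet\<close> gives uniqueness.
\<close>

lemma face_normal_facet:
  assumes a: "a \<in> C"
  shows "face_normal (convex hull C) (facet a) = - (1 / norm (N a)) *\<^sub>R N a"
  unfolding face_normal_def
proof (rule the_equality, intro conjI ballI)
  have N: "N a \<noteq> 0" using a by (rule N_nonzero)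
  show "norm (- (1 / norm (N a)) *\<^sub>R N a) = 1" using N by simp
  fix x y assume "x \<in> facet a" "y \<in> convex hull C"
  then have "bary a x = 0" "bary a y \<ge> 0" using a by (auto simp: mem_facet_iff mem_simplex_iff)
  then show "(- (1 / norm (N a)) *\<^sub>R N a) \<bullet> (y - x) \<le> 0"
    using bary_diff[of a y x] by simp
next
  fix \<nu> assume \<nu>: "norm \<nu> = 1 \<and> (\<forall>x\<in>facet a. \<forall>y\<in>convex hull C. \<nu> \<bullet> (y - x) \<le> 0)"
  obtain z where z: "z \<in> facet a" using facet_nonempty[OF a] by blast
  have "\<nu> \<bullet> (y - x) = 0" if xy: "x \<in> facet a" "y \<in> facet a" for x y
  proof -
    have "x \<in> convex hull C" "y \<in> convex hull C" using xy a by (auto simp: mem_facet_iff)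
    then have "\<nu> \<bullet> (y - x) \<le> 0" "\<nu> \<bullet> (x - y) \<le> 0" using \<nu> xy by auto
    then show ?thesis by (simp add: inner_diff_right)
  qed
  from orthogonal_to_facet[OF a this z]
  have \<nu>N: "\<nu> = (\<nu> \<bullet> (a - z)) *\<^sub>R N a" by blast
  have le: "\<nu> \<bullet> (a - z) \<le> 0" using \<nu> z a by (auto simp: hull_inc)
  have "norm \<nu> = \<bar>\<nu> \<bullet> (a - z)\<bar> * norm (N a)" by (subst \<nu>N) simp
  then have "\<nu> \<bullet> (a - z) = - (1 / norm (N a))"
    using \<nu> le N_nonzero[OF a] by (simp add: field_simps)
  then show "\<nu> = - (1 / norm (N a)) *\<^sub>R N a" using \<nu>N by simp
qed

lemma closest_point_facet:
  assumes a: "a \<in> C"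
  shows "closest_point (affine hull facet a) y = y - (bary a y / (norm (N a))\<^sup>2) *\<^sub>R N a"
    (is "_ = ?p")
proof (rule closest_point_unique[symmetric])
  have N: "N a \<noteq> 0" using a by (rule N_nonzero)
  show "convex (affine hull facet a)" "closed (affine hull facet a)"
    by (auto simp: affine_imp_convex affine_affine_hull)
  have p: "bary a ?p = 0"
    using bary_shift[of a y "- (bary a y / (norm (N a))\<^sup>2)" "N a"] N
    by (simp add: power2_norm_eq_inner)
  then show "?p \<in> affine hull facet a" using a by (simp add: affine_hull_facet)
  show "\<forall>z\<in>affine hull facet a. dist y ?p \<le> dist y z"
  proof
    fix z assume "z \<in> affine hull facet a"
    then have "bary a z = 0" using a by (simp add: affine_hull_facet)
    then have "bary a y = N a \<bullet> (y - z)" by (simp add: bary_diff)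
    then have "\<bar>bary a y\<bar> \<le> norm (N a) * norm (y - z)" by (simp add: Cauchy_Schwarz_ineq2)
    then show "dist y ?p \<le> dist y z"
      using N by (simp add: dist_norm power2_eq_square field_simps)
  qed
qed

end

section \<open>The divergence theorem on a simplex\<close>

lemma integrable_indicator_compact:
  fixes f :: "'a::euclidean_space \<Rightarrow> real"
  assumes "compact S" "continuous_on S f"
  shows "integrable lborel (\<lambda>x. indicator S x * f x)"
  using borel_integrable_compact[OF assms] by (simp add: if_distrib indicator_def cong: if_cong)

context simplex_coords
begin

lemma compact_facet: "compact (facet a)"
  unfolding facet_def using finite_C by (intro compact_convex_hull finite_imp_compact) auto

lemma compact_simplex: "compact (convex hull C)"
  using finite_C by (intro compact_convex_hull finite_imp_compact) auto

text \<open>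
  This unfolds the surface measure of a facet: the distance to the plane of the facet is
  \<open>\<bar>bary a y\<bar> / norm (N a)\<close>, so the first indicator bounds the height of the prism.
\<close>

lemma surface_integral_prism:
  fixes g :: "real^'n \<Rightarrow> real"
  assumes a: "a \<in> C" and g: "continuous_on (facet a) g"
  shows "integrable (surface_measure (facet a)) g"
    and "has_bochner_integral lborel
           (\<lambda>y. indicator {y. \<bar>bary a y\<bar> \<le> norm (N a) / 2} y *
                (indicator (facet a) (y - (bary a y / (norm (N a))\<^sup>2) *\<^sub>R N a) *
                 g (y - (bary a y / (norm (N a))\<^sup>2) *\<^sub>R N a)))
           (\<integral>x. g x \<partial>surface_measure (facet a))"
proof -
  define \<pi> where "\<pi> y = y - (bary a y / (norm (N a))\<^sup>2) *\<^sub>R N a" for y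
  define P where "P = {y. \<pi> y \<in> facet a \<and> \<bar>bary a y\<bar> \<le> norm (N a) / 2}"
  have N: "N a \<noteq> 0" using a by (rule N_nonzero)
  have cont_\<pi>: "continuous_on UNIV \<pi>"
    unfolding \<pi>_def bary_def by (intro continuous_intros) (use N in auto)
  have dist_\<pi>: "dist y (\<pi> y) \<le> 1/2 \<longleftrightarrow> \<bar>bary a y\<bar> \<le> norm (N a) / 2" for y
    using N by (simp add: \<pi>_def dist_norm field_simps power2_eq_square)
  have surf: "surface_measure (facet a) =
      distr (restrict_space lborel P) (restrict_space borel (facet a)) \<pi>"
    unfolding surface_measure_def Let_def closest_point_facet[OF a] \<pi>_def[symmetric] dist_\<pi>
    by (simp add: P_def \<pi>_def[abs_def])
  have closed_P: "closed P"
  proof -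
    have "P = \<pi> -` facet a \<inter> {y. \<bar>bary a y\<bar> \<le> norm (N a) / 2}" by (auto simp: P_def)
    moreover have "closed (\<pi> -` facet a)"
      using cont_\<pi> compact_facet[of a] by (auto intro!: continuous_closed_vimage
        simp: compact_imp_closed continuous_on_eq_continuous_at)
    moreover have "closed {y. \<bar>bary a y\<bar> \<le> norm (N a) / 2}"
      by (intro closed_Collect_le continuous_intros continuous_bary)
    ultimately show ?thesis by auto
  qed
  have "bounded P"
  proof -
    obtain B where B: "\<And>x. x \<in> facet a \<Longrightarrow> norm x \<le> B"
      using compact_facet[of a] by (metis compact_imp_bounded bounded_iff)
    have "norm y \<le> B + 1/2" if "y \<in> P" for y
    proof -
      have "norm (\<pi> y) \<le> B" "dist y (\<pi> y) \<le> 1/2"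
        using that B dist_\<pi>[THEN iffD2] by (auto simp: P_def)
      then show ?thesis using norm_triangle_sub[of y "\<pi> y"] by (simp add: dist_norm)
    qed
    then show ?thesis by (auto simp: bounded_iff)
  qed
  then have comp_P: "compact P" using closed_P by (simp add: compact_eq_bounded_closed)
  have P_meas: "P \<in> sets borel" using closed_P by simp
  have \<pi>_meas: "\<pi> \<in> restrict_space lborel P \<rightarrow>\<^sub>M restrict_space borel (facet a)"
    by (rule measurable_restrict_space2)
      (auto simp: P_def space_restrict_space intro!: measurable_restrict_space1
        borel_measurable_continuous_onI cont_\<pi>)
  have g_meas: "g \<in> borel_measurable (restrict_space borel (facet a))"
    using g by (rule borel_measurable_continuous_on_restrict)
  have "continuous_on P (\<lambda>y. g (\<pi> y))"
    by (rule continuous_on_compose2[OF g]) (auto intro: continuous_on_subset[OF cont_\<pi>] simp: P_def)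
  then have int: "integrable lborel (\<lambda>y. indicator P y *\<^sub>R g (\<pi> y))"
    using integrable_indicator_compact[OF comp_P] by simp
  then show "integrable (surface_measure (facet a)) g"
    unfolding surf using P_meas
    by (simp add: integrable_distr_eq[OF \<pi>_meas g_meas] integrable_restrict_space)
  have "(\<integral>x. g x \<partial>surface_measure (facet a)) = (\<integral>y. indicator P y *\<^sub>R g (\<pi> y) \<partial>lborel)"
    unfolding surf using P_meas
    by (simp add: integral_distr[OF \<pi>_meas g_meas] integral_restrict_space)
  with int have "has_bochner_integral lborel (\<lambda>y. indicator P y *\<^sub>R g (\<pi> y))
      (\<integral>x. g x \<partial>surface_measure (facet a))"
    by (simp add: has_bochner_integral_iff)
  moreover have "(\<lambda>y. indicator P y *\<^sub>R g (\<pi> y)) =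
      (\<lambda>y. indicator {y. \<bar>bary a y\<bar> \<le> norm (N a) / 2} y * (indicator (facet a) (\<pi> y) * g (\<pi> y)))"
    by (rule ext) (simp add: P_def indicator_def, blast)
  ultimately show "has_bochner_integral lborel
           (\<lambda>y. indicator {y. \<bar>bary a y\<bar> \<le> norm (N a) / 2} y *
                (indicator (facet a) (y - (bary a y / (norm (N a))\<^sup>2) *\<^sub>R N a) *
                 g (y - (bary a y / (norm (N a))\<^sup>2) *\<^sub>R N a)))
           (\<integral>x. g x \<partial>surface_measure (facet a))"
    by (simp only: \<pi>_def)
qed

text \<open>
  The projection onto the plane of the facet along \<open>h\<close> can replace the orthogonal one, since the two
  prisms differ by a shear that fixes this plane.  Slicing the sheared prism along \<open>h\<close>, every line
  contributes the length \<open>norm (N a)\<close> of its intersection with \<open>\<bar>bary a y\<bar> \<le> norm (N a) / 2\<close>, because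
  \<open>bary a\<close> changes at unit speed along \<open>h\<close>.
\<close>

lemma surface_integral_oblique:
  fixes g :: "real^'n \<Rightarrow> real"
  assumes a: "a \<in> C" and b: "b \<in> C" and Nb: "N b \<bullet> h = 1" and Na: "\<bar>N a \<bullet> h\<bar> = 1"
    and g: "continuous_on (facet a) g"
  shows "has_bochner_integral lborel
           (\<lambda>y. indicator {y. 0 \<le> bary b y \<and> bary b y \<le> 1} y *
                (indicator (facet a) (y - (bary a y / (N a \<bullet> h)) *\<^sub>R h) *
                 g (y - (bary a y / (N a \<bullet> h)) *\<^sub>R h)))
           ((\<integral>x. g x \<partial>surface_measure (facet a)) / norm (N a))"
proof -
  let ?I = "\<integral>x. g x \<partial>surface_measure (facet a)"
  define \<psi> where "\<psi> x = indicator (facet a) x * g x" for x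
  define \<epsilon> where "\<epsilon> = N a \<bullet> h"
  define \<rho> where "\<rho> y = y - (bary a y / \<epsilon>) *\<^sub>R h" for y
  define f where "f y = indicator {y. \<bar>bary a y\<bar> \<le> norm (N a) / 2} y * \<psi> (\<rho> y)" for y
  \<comment> \<open>the shear along \<open>k\<close> carries the orthogonal projection to the projection along \<open>h\<close>\<close>
  define k where "k = (1 / \<epsilon>) *\<^sub>R h - (1 / (norm (N a))\<^sup>2) *\<^sub>R N a"
  have N: "N a \<noteq> 0" using a by (rule N_nonzero)
  have \<epsilon>: "\<epsilon> \<noteq> 0" "\<bar>\<epsilon>\<bar> = 1" using Na by (auto simp: \<epsilon>_def)
  have [measurable]: "bary c \<in> borel_measurable borel" for c
    using continuous_bary by (rule borel_measurable_continuous_onI)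
  have [measurable]: "\<psi> \<in> borel_measurable borel"
    unfolding \<psi>_def
    using borel_measurable_continuous_on_indicator[OF _ g] compact_facet[of a]
    by (simp add: compact_imp_closed)
  have [measurable]: "f \<in> borel_measurable borel"
    unfolding f_def \<rho>_def by measurable
  have Nk: "N a \<bullet> k = 0"
    using N \<epsilon> by (simp add: k_def inner_diff_right \<epsilon>_def[symmetric] power2_norm_eq_inner)
  have f_shear: "f (y + (N a \<bullet> y + \<beta> a) *\<^sub>R k) =
      indicator {y. \<bar>bary a y\<bar> \<le> norm (N a) / 2} y *
        \<psi> (y - (bary a y / (norm (N a))\<^sup>2) *\<^sub>R N a)" for y
  proof -
    have "bary a (y + bary a y *\<^sub>R k) = bary a y" by (simp add: bary_shift Nk)
    moreover from this have "\<rho> (y + bary a y *\<^sub>R k) = y - (bary a y / (norm (N a))\<^sup>2) *\<^sub>R N a"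
      by (simp add: \<rho>_def k_def algebra_simps)
    ultimately show ?thesis by (simp add: f_def bary_def[symmetric] indicator_def)
  qed
  have "has_bochner_integral lborel (\<lambda>y. f (y + (N a \<bullet> y + \<beta> a) *\<^sub>R k)) ?I"
    using surface_integral_prism(2)[OF a g] by (simp only: f_shear \<psi>_def)
  moreover have "(\<lambda>y. y + (N a \<bullet> y + \<beta> a) *\<^sub>R k) \<in> lborel \<rightarrow>\<^sub>M lborel" by simp
  ultimately have "has_bochner_integral (distr lborel lborel (\<lambda>y. y + (N a \<bullet> y + \<beta> a) *\<^sub>R k)) f ?I"
    by (subst has_bochner_integral_distr) auto
  then have f_int: "integrable lborel f" "(\<integral>y. f y \<partial>lborel) = ?I"
    by (simp_all only: lborel_distr_shear[OF Nk] has_bochner_integral_iff)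
  have line: "(\<integral>s. f (y + s *\<^sub>R h) \<partial>lborel) = norm (N a) * \<psi> (\<rho> y)" for y
  proof -
    let ?r = "norm (N a) / 2"
    have \<rho>: "\<rho> (y + s *\<^sub>R h) = \<rho> y" for s
      using \<epsilon> by (simp add: \<rho>_def bary_shift \<epsilon>_def[symmetric] add_divide_distrib algebra_simps)
    have \<epsilon>_cases: "\<epsilon> = 1 \<or> \<epsilon> = -1" using \<epsilon>(2) by linarith
    \<comment> \<open>the parameter at which the line crosses the plane of the facet\<close>
    define m where "m = - \<epsilon> * bary a y"
    have "\<bar>t + s * \<epsilon>\<bar> \<le> r \<longleftrightarrow> s \<in> {- \<epsilon> * t - r .. - \<epsilon> * t + r}" for s t r :: real
      using \<epsilon>_cases by (auto simp: abs_le_iff)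
    then have m: "\<bar>bary a y + s * \<epsilon>\<bar> \<le> ?r \<longleftrightarrow> s \<in> {m - ?r .. m + ?r}" for s
      unfolding m_def by blast
    have "f (y + s *\<^sub>R h) = indicator {m - ?r .. m + ?r} s * \<psi> (\<rho> y)" for s
    proof -
      have "y + s *\<^sub>R h \<in> {y. \<bar>bary a y\<bar> \<le> ?r} \<longleftrightarrow> s \<in> {m - ?r .. m + ?r}"
        unfolding m[symmetric] \<epsilon>_def by (simp only: mem_Collect_eq bary_shift)
      then show ?thesis by (simp only: f_def \<rho> indicator_def)
    qed
    then show ?thesis using norm_ge_zero[of "N a"] by simp
  qed
  have l: "bary b (y + s *\<^sub>R h) = bary b y + s" for y s
    by (simp add: bary_shift Nb)
  have "has_bochner_integral lborel (\<lambda>y. indicator {y. 0 \<le> bary b y \<and> bary b y \<le> 1} y *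
      (norm (N a) * \<psi> (\<rho> y))) ?I"
    using integral_line_slicing[of "bary b" h f, OF _ l f_int(1)] by (simp add: line f_int(2))
  from has_bochner_integral_mult_right[OF this, of "1 / norm (N a)"]
  show ?thesis using N
    by (simp add: \<psi>_def \<rho>_def \<epsilon>_def ac_simps)
qed

text \<open>
  The line through \<open>y\<close> meets the simplex for \<open>- bary b y \<le> s \<le> bary a y\<close>, provided that the other
  coordinates are nonnegative; the end points of this interval are the entry into \<open>facet b\<close> and the
  exit through \<open>facet a\<close>.  If the line misses the simplex, both sides vanish.
\<close>

lemma line_integral_in_simplex:
  fixes g :: "real^'n \<Rightarrow> real" and D :: "real^'n \<Rightarrow> real^'n \<Rightarrow> real"
  assumes a: "a \<in> C" and b: "b \<in> C" and ab: "a \<noteq> b"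
    and D: "\<And>x. x \<in> convex hull C \<Longrightarrow> (g has_derivative D x) (at x within convex hull C)"
    and cont: "continuous_on (convex hull C) (\<lambda>x. D x (b - a))"
  shows "(\<integral>s. indicator (convex hull C) (y + s *\<^sub>R (b - a)) * D (y + s *\<^sub>R (b - a)) (b - a) \<partial>lborel)
       = indicator (facet a) (y + bary a y *\<^sub>R (b - a)) * g (y + bary a y *\<^sub>R (b - a))
       - indicator (facet b) (y - bary b y *\<^sub>R (b - a)) * g (y - bary b y *\<^sub>R (b - a))"
proof -
  define h where "h = b - a"
  have Nh: "N a \<bullet> h = -1" "N b \<bullet> h = 1" "\<And>c. c \<in> C \<Longrightarrow> c \<noteq> a \<Longrightarrow> c \<noteq> b \<Longrightarrow> N c \<bullet> h = 0"
    using a b ab by (auto simp: h_def N_edge)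
  \<comment> \<open>whether the line through \<open>y\<close> meets the simplex\<close>
  define hit where "hit \<longleftrightarrow> (\<forall>c\<in>C - {a, b}. 0 \<le> bary c y) \<and> - bary b y \<le> bary a y"
  have mem: "y + s *\<^sub>R h \<in> convex hull C \<longleftrightarrow>
      (\<forall>c\<in>C - {a, b}. 0 \<le> bary c y) \<and> s \<in> {- bary b y .. bary a y}" for s
  proof -
    have "y + s *\<^sub>R h \<in> convex hull C \<longleftrightarrow> (\<forall>c\<in>C - {a, b}. 0 \<le> bary c (y + s *\<^sub>R h)) \<and>
        0 \<le> bary a (y + s *\<^sub>R h) \<and> 0 \<le> bary b (y + s *\<^sub>R h)"
      unfolding mem_simplex_iff using a b by blast
    moreover have "(\<forall>c\<in>C - {a, b}. 0 \<le> bary c (y + s *\<^sub>R h)) \<longleftrightarrow> (\<forall>c\<in>C - {a, b}. 0 \<le> bary c y)"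
      by (intro ball_cong refl) (auto simp: bary_shift Nh)
    ultimately show ?thesis by (auto simp: bary_shift Nh)
  qed
  have exit: "y + bary a y *\<^sub>R h \<in> facet a \<longleftrightarrow> hit"
    using a mem[of "bary a y"] by (auto simp: mem_facet_iff bary_shift Nh hit_def)
  have entry: "y - bary b y *\<^sub>R h \<in> facet b \<longleftrightarrow> hit"
    using b mem[of "- bary b y"] bary_shift[of b y "- bary b y" h]
    by (auto simp: mem_facet_iff Nh hit_def)
  show ?thesis
    unfolding h_def[symmetric]
  proof (cases hit)
    case False
    then have "y + s *\<^sub>R h \<notin> convex hull C" for s
      using mem[of s] by (auto simp: hit_def)
    then show "(\<integral>s. indicator (convex hull C) (y + s *\<^sub>R h) * D (y + s *\<^sub>R h) h \<partial>lborel)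
       = indicator (facet a) (y + bary a y *\<^sub>R h) * g (y + bary a y *\<^sub>R h)
       - indicator (facet b) (y - bary b y *\<^sub>R h) * g (y - bary b y *\<^sub>R h)"
      using False by (simp add: exit entry)
  next
    case True
    let ?J = "{- bary b y .. bary a y}"
    have J: "y + s *\<^sub>R h \<in> convex hull C \<longleftrightarrow> s \<in> ?J" for s
      using mem[of s] True by (auto simp: hit_def)
    have "(\<integral>s. indicator (convex hull C) (y + s *\<^sub>R h) * D (y + s *\<^sub>R h) h \<partial>lborel)
        = (\<integral>s. indicator ?J s *\<^sub>R D (y + s *\<^sub>R h) h \<partial>lborel)"
      by (simp add: indicator_def J)
    also have "\<dots> = g (y + bary a y *\<^sub>R h) - g (y + (- bary b y) *\<^sub>R h)"
    proof (rule integral_FTC_atLeastAtMost)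
      show "- bary b y \<le> bary a y" using True by (simp add: hit_def)
      show "continuous_on ?J (\<lambda>s. D (y + s *\<^sub>R h) h)"
        by (rule continuous_on_compose2[OF cont[folded h_def]])
          (auto intro!: continuous_intros simp: J)
      fix s assume "- bary b y \<le> s" "s \<le> bary a y"
      then have s: "y + s *\<^sub>R h \<in> convex hull C" by (simp add: J)
      have "((\<lambda>s. y + s *\<^sub>R h) has_derivative (\<lambda>t. t *\<^sub>R h)) (at s within ?J)"
        by (auto intro!: derivative_eq_intros)
      moreover have "(g has_derivative D (y + s *\<^sub>R h)) (at (y + s *\<^sub>R h) within (\<lambda>s. y + s *\<^sub>R h) ` ?J)"
        by (rule has_derivative_subset[OF D[OF s]]) (auto simp: J)
      ultimately have "((\<lambda>s. g (y + s *\<^sub>R h)) has_derivative (\<lambda>t. D (y + s *\<^sub>R h) (t *\<^sub>R h))) (at s within ?J)"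
        by (rule has_derivative_in_compose)
      moreover have "linear (D (y + s *\<^sub>R h))"
        using D[OF s] by (rule has_derivative_linear)
      ultimately show "((\<lambda>s. g (y + s *\<^sub>R h)) has_vector_derivative D (y + s *\<^sub>R h) h) (at s within ?J)"
        by (simp add: has_vector_derivative_def linear_scale)
    qed
    finally show "(\<integral>s. indicator (convex hull C) (y + s *\<^sub>R h) * D (y + s *\<^sub>R h) h \<partial>lborel)
       = indicator (facet a) (y + bary a y *\<^sub>R h) * g (y + bary a y *\<^sub>R h)
       - indicator (facet b) (y - bary b y *\<^sub>R h) * g (y - bary b y *\<^sub>R h)"
      using True by (simp add: exit entry)
  qed
qed

lemma simplex_edge_derivative_integral:
  fixes g :: "real^'n \<Rightarrow> real" and D :: "real^'n \<Rightarrow> real^'n \<Rightarrow> real"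
  assumes a: "a \<in> C" and b: "b \<in> C" and ab: "a \<noteq> b"
    and D: "\<And>x. x \<in> convex hull C \<Longrightarrow> (g has_derivative D x) (at x within convex hull C)"
    and cont: "continuous_on (convex hull C) (\<lambda>x. D x (b - a))"
  shows "(\<integral>x. indicator (convex hull C) x * D x (b - a) \<partial>lborel)
       = (\<integral>x. g x \<partial>surface_measure (facet a)) / norm (N a)
       - (\<integral>x. g x \<partial>surface_measure (facet b)) / norm (N b)"
proof -
  let ?h = "b - a"
  let ?w = "\<lambda>y. indicator {y. 0 \<le> bary b y \<and> bary b y \<le> 1} y :: real"
  have Nh: "N a \<bullet> ?h = -1" "N b \<bullet> ?h = 1" using a b ab by (auto simp: N_edge)
  have "continuous_on (convex hull C) g"
    using D by (meson has_derivative_continuous continuous_on_eq_continuous_within)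
  then have g: "continuous_on (facet c) g" if "c \<in> C" for c
    by (rule continuous_on_subset) (use that in \<open>auto simp: mem_facet_iff\<close>)
  have l: "bary b (y + s *\<^sub>R ?h) = bary b y + s" for y s
    by (simp add: bary_shift Nh)
  have "has_bochner_integral lborel
      (\<lambda>y. ?w y * (indicator (facet a) (y + bary a y *\<^sub>R ?h) * g (y + bary a y *\<^sub>R ?h)
                 - indicator (facet b) (y - bary b y *\<^sub>R ?h) * g (y - bary b y *\<^sub>R ?h)))
      (\<integral>x. indicator (convex hull C) x * D x ?h \<partial>lborel)"
    using integral_line_slicing[OF _ l integrable_indicator_compact[OF compact_simplex cont]]
    by (simp add: line_integral_in_simplex[OF a b ab D cont] borel_measurable_continuous_onI[OF continuous_bary])
  moreover have "has_bochner_integral lborel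
      (\<lambda>y. ?w y * (indicator (facet a) (y + bary a y *\<^sub>R ?h) * g (y + bary a y *\<^sub>R ?h)
                 - indicator (facet b) (y - bary b y *\<^sub>R ?h) * g (y - bary b y *\<^sub>R ?h)))
      ((\<integral>x. g x \<partial>surface_measure (facet a)) / norm (N a)
       - (\<integral>x. g x \<partial>surface_measure (facet b)) / norm (N b))"
    using has_bochner_integral_diff[OF surface_integral_oblique[OF a b Nh(2) _ g[OF a]]
        surface_integral_oblique[OF b b Nh(2) _ g[OF b]]]
    by (simp add: Nh right_diff_distrib)
  ultimately show ?thesis by (rule has_bochner_integral_eq)
qed

text \<open>
  Both sides are linear in \<open>h\<close>, and \<open>h\<close> is the combination of the edges \<open>c - a\<close> with the barycentric
  coordinates of \<open>h + a\<close> as coefficients.  For the edge \<open>b - a\<close> only the facets opposite \<open>a\<close> and \<open>b\<close>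
  contribute on the right, the others being parallel to it.
\<close>

lemma simplex_derivative_integral:
  fixes g :: "real^'n \<Rightarrow> real" and D :: "real^'n \<Rightarrow> real^'n \<Rightarrow> real"
  assumes D: "\<And>x. x \<in> convex hull C \<Longrightarrow> (g has_derivative D x) (at x within convex hull C)"
    and cont: "\<And>h. continuous_on (convex hull C) (\<lambda>x. D x h)"
  shows "(\<integral>x. indicator (convex hull C) x * D x h \<partial>lborel)
       = (\<Sum>e | e facet_of convex hull C.
            (face_normal (convex hull C) e \<bullet> h) * (\<integral>x. g x \<partial>surface_measure e))"
proof -
  let ?I = "\<lambda>c. \<integral>x. g x \<partial>surface_measure (facet c)"
  let ?n = "\<lambda>c. face_normal (convex hull C) (facet c)"
  have "C \<noteq> {}" using card_C by auto
  then obtain a where a: "a \<in> C" by blast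
  have edge: "(\<integral>x. indicator (convex hull C) x * D x (b - a) \<partial>lborel) = (\<Sum>c\<in>C. (?n c \<bullet> (b - a)) * ?I c)"
    if b: "b \<in> C" for b
  proof (cases "a = b")
    case True
    have "(\<lambda>x. indicator (convex hull C) x * D x 0) = (\<lambda>x. 0)"
      using linear_0[OF has_derivative_linear[OF D]] by (auto simp: indicator_def fun_eq_iff)
    then show ?thesis using True by simp
  next
    case False
    have "(\<Sum>c\<in>C. (?n c \<bullet> (b - a)) * ?I c) = (\<Sum>c\<in>{a, b}. (?n c \<bullet> (b - a)) * ?I c)"
      by (rule sum.mono_neutral_right) (auto simp: finite_C a b face_normal_facet N_edge)
    also have "\<dots> = ?I a / norm (N a) - ?I b / norm (N b)"
      using False a b by (simp add: face_normal_facet N_edge)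
    finally show ?thesis using simplex_edge_derivative_integral[OF a b False D cont] by simp
  qed
  define \<mu> where "\<mu> c = bary c (h + a)" for c
  have h: "h = (\<Sum>c\<in>C. \<mu> c *\<^sub>R (c - a))"
  proof -
    have "(\<Sum>c\<in>C. \<mu> c *\<^sub>R (c - a)) = (\<Sum>c\<in>C. \<mu> c *\<^sub>R c) - (\<Sum>c\<in>C. \<mu> c) *\<^sub>R a"
      by (simp add: scaleR_diff_right sum_subtractf scaleR_sum_left)
    then show ?thesis using bary_representation[of "h + a"] by (simp add: \<mu>_def)
  qed
  have "indicator (convex hull C) x * D x h
      = (\<Sum>c\<in>C. \<mu> c * (indicator (convex hull C) x * D x (c - a)))" for x
  proof (cases "x \<in> convex hull C")
    case True
    then have lin: "linear (D x)" using D has_derivative_linear by blast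
    show ?thesis using True by (subst h) (simp add: linear_sum[OF lin] linear_scale[OF lin])
  qed simp
  then have "(\<integral>x. indicator (convex hull C) x * D x h \<partial>lborel)
      = (\<Sum>c\<in>C. \<mu> c * (\<integral>x. indicator (convex hull C) x * D x (c - a) \<partial>lborel))"
    by (simp add: Bochner_Integration.integral_sum integrable_indicator_compact[OF compact_simplex cont])
  also have "\<dots> = (\<Sum>b\<in>C. \<mu> b * (\<Sum>c\<in>C. (?n c \<bullet> (b - a)) * ?I c))"
    by (simp add: edge)
  also have "\<dots> = (\<Sum>c\<in>C. (?n c \<bullet> (\<Sum>b\<in>C. \<mu> b *\<^sub>R (b - a))) * ?I c)"
    unfolding inner_sum_right sum_distrib_left sum_distrib_right
    by (subst sum.swap) (simp add: mult.assoc)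
  also have "\<dots> = (\<Sum>c\<in>C. (?n c \<bullet> h) * ?I c)"
    using h by simp
  also have "\<dots> = (\<Sum>e\<in>facet ` C. (face_normal (convex hull C) e \<bullet> h) * (\<integral>x. g x \<partial>surface_measure e))"
    by (simp add: sum.reindex[OF inj_on_facet])
  also have "facet ` C = {e. e facet_of convex hull C}"
    by (auto simp: facets)
  finally show ?thesis .
qed

end

section \<open>Green's formula for continuously differentiable fields\<close>

text \<open>
  The frontier of a convex set is negligible.  By completeness of Lebesgue measure the two integrands
  are integrable together, and otherwise both integrals are 0 by convention.
\<close>

lemma integral_lebesgue_on_interior:
  fixes f :: "'a::euclidean_space \<Rightarrow> real"
  assumes "compact K" "convex K"
  shows "integral\<^sup>L (lebesgue_on K) f = integral\<^sup>L (lebesgue_on (interior K)) f"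
proof -
  let ?F = "\<lambda>x. indicator K x *\<^sub>R f x" and ?G = "\<lambda>x. indicator (interior K) x *\<^sub>R f x"
  have [simp]: "K \<in> sets lebesgue" "interior K \<in> sets lebesgue"
    using assms(1) by (auto simp: compact_imp_closed)
  have "frontier K \<in> null_sets lebesgue"
    using negligible_convex_frontier[OF assms(2)] by (simp add: negligible_iff_null_sets)
  then have not_frontier: "AE x in lebesgue. x \<notin> frontier K" by (rule AE_not_in)
  have "?F x = ?G x" if "x \<notin> frontier K" for x
    using that assms(1) interior_subset[of K]
    by (auto simp: frontier_def compact_imp_closed closure_closed indicator_def)
  then have ae: "AE x in lebesgue. ?F x = ?G x" by (rule eventually_mono[OF not_frontier])
  then have ae': "AE x in lebesgue. ?G x = ?F x" by eventually_elim (rule sym)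
  have "integral\<^sup>L lebesgue ?F = integral\<^sup>L lebesgue ?G"
  proof (rule integral_eq_cases)
    show "integrable lebesgue ?F \<longleftrightarrow> integrable lebesgue ?G"
      using integrable_cong_AE_imp[OF _ borel_measurable_AE[OF _ ae] ae]
        integrable_cong_AE_imp[OF _ borel_measurable_AE[OF _ ae'] ae'] by blast
    assume "integrable lebesgue ?F" "integrable lebesgue ?G"
    then show "integral\<^sup>L lebesgue ?F = integral\<^sup>L lebesgue ?G"
      using ae by (intro integral_cong_AE) auto
  qed
  then show ?thesis by (simp add: integral_restrict_space)
qed

lemma integral_lebesgue_on_interior_continuous:
  fixes f :: "'a::euclidean_space \<Rightarrow> real"
  assumes "compact K" "convex K" "continuous_on K f"
  shows "integral\<^sup>L (lebesgue_on (interior K)) f = (\<integral>x. indicator K x * f x \<partial>lborel)"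
proof -
  have K [simp]: "K \<in> sets lebesgue" using assms(1) by (auto simp: compact_imp_closed)
  have "(\<lambda>x. indicator K x * f x) \<in> borel_measurable lborel"
    using integrable_indicator_compact[OF assms(1,3)] by simp
  then have "(\<integral>x. indicator K x * f x \<partial>lebesgue) = (\<integral>x. indicator K x * f x \<partial>lborel)"
    by (rule integral_completion)
  then show ?thesis
    by (simp add: integral_lebesgue_on_interior[OF assms(1,2), symmetric] integral_restrict_space)
qed

lemma integrable_lebesgue_on_interior:
  fixes f :: "'a::euclidean_space \<Rightarrow> real"
  assumes "bounded K" "f \<in> borel_measurable (lebesgue_on (interior K))"
    and bound: "\<And>x. x \<in> interior K \<Longrightarrow> \<bar>f x\<bar> \<le> B"
  shows "integrable (lebesgue_on (interior K)) f"
proof -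
  have lm: "interior K \<in> lmeasurable" using assms(1) by (rule lmeasurable_interior)
  interpret finite_measure "lebesgue_on (interior K)"
    using lm by (rule finite_measure_lebesgue_on)
  show ?thesis
    by (rule integrable_const_bound[OF _ assms(2)])
      (use bound in \<open>auto intro!: AE_I2 simp: space_restrict_space\<close>)
qed

text \<open>
  Continuous differentiability witnessed by some derivative \<open>D\<close>.  At a boundary point of \<open>S\<close> the
  derivative within \<open>S\<close> can fail to be unique, so that the product rule need not hold for the
  \<open>frechet_derivative\<close> selected there; with the witness as a parameter the class is closed under the
  usual operations, and at interior points \<open>D\<close> is the derivative.
\<close>

definition C1_ext :: "'a::real_normed_vector set \<Rightarrow> ('a \<Rightarrow> 'b::real_normed_vector) \<Rightarrow>
    ('a \<Rightarrow> 'a \<Rightarrow> 'b) \<Rightarrow> bool" where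
  "C1_ext S f D \<longleftrightarrow> (\<forall>x\<in>S. (f has_derivative D x) (at x within S)) \<and>
     (\<forall>h. continuous_on S (\<lambda>x. D x h))"

lemma C1_ext_D:
  assumes "C1_ext S f D"
  shows "x \<in> S \<Longrightarrow> (f has_derivative D x) (at x within S)"
    and "continuous_on S (\<lambda>x. D x h)" and "continuous_on S f"
  using assms by (auto simp: C1_ext_def continuous_on_eq_continuous_within
    dest: has_derivative_continuous)

lemma C1_on_imp_C1_ext:
  "C1_on S f \<Longrightarrow> C1_ext S f (\<lambda>x. frechet_derivative f (at x within S))"
  by (auto simp: C1_on_def C1_ext_def differentiable_on_def frechet_derivative_works)

lemma C1_ext_subset: "C1_ext S f D \<Longrightarrow> K \<subseteq> S \<Longrightarrow> C1_ext K f D"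
  by (auto simp: C1_ext_def intro: has_derivative_subset continuous_on_subset)

lemma C1_ext_add:
  "C1_ext S f D \<Longrightarrow> C1_ext S g E \<Longrightarrow> C1_ext S (\<lambda>x. f x + g x) (\<lambda>x h. D x h + E x h)"
  by (auto simp: C1_ext_def intro: has_derivative_add continuous_on_add)

lemma C1_ext_scaleR:
  fixes f :: "'a::real_normed_vector \<Rightarrow> real"
  assumes "C1_ext S f D" "C1_ext S g E"
  shows "C1_ext S (\<lambda>x. f x *\<^sub>R g x) (\<lambda>x h. f x *\<^sub>R E x h + D x h *\<^sub>R g x)"
  using assms C1_ext_D(3)[OF assms(1)] C1_ext_D(3)[OF assms(2)]
  by (auto simp: C1_ext_def intro!: has_derivative_scaleR continuous_intros)

lemma C1_ext_component:
  fixes f :: "'a::real_normed_vector \<Rightarrow> real^'n"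
  shows "C1_ext S f D \<Longrightarrow> C1_ext S (\<lambda>x. f x $ i) (\<lambda>x h. D x h $ i)"
  by (auto simp: C1_ext_def intro: bounded_linear.has_derivative[OF bounded_linear_vec_nth]
      continuous_on_component)

lemma C1_ext_const: "\<exists>D. C1_ext S (\<lambda>x. k) D"
  by (rule exI[of _ "\<lambda>x h. 0"]) (auto simp: C1_ext_def)

lemma C1_ext_ident_component: "\<exists>D. C1_ext S (\<lambda>x :: real^'n. x $ i) D"
  by (rule exI[of _ "\<lambda>x h. h $ i"]) (auto simp: C1_ext_def intro: bounded_linear.has_derivative[OF bounded_linear_vec_nth])

lemma C1_ext_sum:
  assumes "\<And>i. i \<in> I \<Longrightarrow> \<exists>D. C1_ext S (f i) D"
  shows "\<exists>D. C1_ext S (\<lambda>x. \<Sum>i\<in>I. f i x) D"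
  using assms
proof (induction I rule: infinite_finite_induct)
  case (insert i I)
  then have "\<exists>D. C1_ext S (f i) D" "\<exists>E. C1_ext S (\<lambda>x. \<Sum>i\<in>I. f i x) E" by simp_all
  then obtain D E where "C1_ext S (f i) D" "C1_ext S (\<lambda>x. \<Sum>i\<in>I. f i x) E" by blast
  then have "C1_ext S (\<lambda>x. \<Sum>i\<in>insert i I. f i x) (\<lambda>x h. D x h + E x h)"
    using C1_ext_add insert.hyps by simp
  then show ?case by (rule exI[of "C1_ext S _"])
qed (simp_all add: C1_ext_const)

lemma C1_ext_mult:
  fixes f g :: "'a::real_normed_vector \<Rightarrow> real"
  assumes "\<exists>D. C1_ext S f D" "\<exists>D. C1_ext S g D"
  shows "\<exists>D. C1_ext S (\<lambda>x. f x * g x) D"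
proof -
  obtain D E where "C1_ext S f D" "C1_ext S g E" using assms by blast
  then have "C1_ext S (\<lambda>x. f x * g x) (\<lambda>x h. f x *\<^sub>R E x h + D x h *\<^sub>R g x)"
    using C1_ext_scaleR[of S f D g E] by simp
  then show ?thesis by (rule exI[of "C1_ext S _"])
qed

lemma C1_ext_power:
  fixes f :: "'a::real_normed_vector \<Rightarrow> real"
  assumes "\<exists>D. C1_ext S f D"
  shows "\<exists>D. C1_ext S (\<lambda>x. f x ^ n) D"
proof (induction n)
  case 0
  then show ?case using C1_ext_const by simp
next
  case (Suc n)
  then show ?case using C1_ext_mult[OF assms] by simp
qed

lemma C1_ext_prod:
  fixes f :: "'i \<Rightarrow> 'a::real_normed_vector \<Rightarrow> real"
  assumes "\<And>i. i \<in> I \<Longrightarrow> \<exists>D. C1_ext S (f i) D"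
  shows "\<exists>D. C1_ext S (\<lambda>x. \<Prod>i\<in>I. f i x) D"
  using assms
proof (induction I rule: infinite_finite_induct)
  case (insert i I)
  then show ?case using C1_ext_mult[of S "f i" "\<lambda>x. \<Prod>i\<in>I. f i x"] by simp
qed (simp_all add: C1_ext_const)

lemma poly_space_C1_ext:
  fixes S :: "(real^'n) set"
  assumes "v \<in> poly_space k S"
  shows "\<exists>E. C1_ext S v E"
proof -
  obtain a where a: "\<And>x. x \<in> S \<Longrightarrow> v x = (\<Sum>\<alpha> | (\<Sum>i\<in>UNIV. \<alpha> i) \<le> k. a \<alpha> * (\<Prod>i\<in>UNIV. (x $ i) ^ \<alpha> i))"
    using assms by (auto simp: poly_space_def)
  have "\<exists>E. C1_ext S (\<lambda>x :: real^'n. \<Sum>\<alpha> | (\<Sum>i\<in>UNIV. \<alpha> i) \<le> k. a \<alpha> * (\<Prod>i\<in>UNIV. (x $ i) ^ \<alpha> i)) E"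
    by (rule C1_ext_sum, rule C1_ext_mult, rule C1_ext_const, rule C1_ext_prod,
        rule C1_ext_power, rule C1_ext_ident_component)
  then obtain E where E: "C1_ext S (\<lambda>x. \<Sum>\<alpha> | (\<Sum>i\<in>UNIV. \<alpha> i) \<le> k. a \<alpha> * (\<Prod>i\<in>UNIV. (x $ i) ^ \<alpha> i)) E"
    by blast
  have "(v has_derivative E x) (at x within S)" if "x \<in> S" for x
    by (rule has_derivative_transform[OF that a C1_ext_D(1)[OF E that]])
  then have "C1_ext S v E" using C1_ext_D(2)[OF E] by (simp add: C1_ext_def)
  then show ?thesis by blast
qed

lemma frechet_derivative_interior:
  assumes "C1_ext S f D" "x \<in> interior S"
  shows "frechet_derivative f (at x within S) = D x"
proof -
  have "(f has_derivative D x) (at x)"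
    using assms C1_ext_D(1) interior_subset by (metis at_within_interior subsetD)
  then show ?thesis
    using assms(2) frechet_derivative_at by (metis at_within_interior)
qed

lemma grad_interior:
  "C1_ext S f D \<Longrightarrow> x \<in> interior S \<Longrightarrow> grad S f x = (\<chi> i. D x (axis i 1))"
  by (simp add: grad_def frechet_derivative_interior)

lemma divg_interior:
  "C1_ext S F D \<Longrightarrow> x \<in> interior S \<Longrightarrow> divg S F x = (\<Sum>i\<in>UNIV. D x (axis i 1) $ i)"
  by (simp add: divg_def trace_def jacobian_def matrix_def frechet_derivative_interior)

lemma grad_subset:
  assumes "C1_ext S f D" "K \<subseteq> S" "x \<in> interior K"
  shows "grad K f x = grad S f x"
  using assms grad_interior[OF C1_ext_subset[OF assms(1,2)] assms(3)]
    grad_interior[OF assms(1)] interior_mono[OF assms(2)] by auto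

lemma simplex_coords_exist:
  fixes K :: "(real^'n) set"
  assumes "int CARD('n) simplex K"
  obtains C N \<beta> where "simplex_coords C N \<beta>" "K = convex hull C"
proof -
  obtain C where C: "\<not> affine_dependent C" "card C = CARD('n) + 1" "K = convex hull C"
    using assms unfolding simplex_def by auto
  from affine_functionals_of_simplex_vertices[OF C(1)] C(2)
  obtain N \<beta> where dual: "\<And>a c. a \<in> C \<Longrightarrow> c \<in> C \<Longrightarrow> N a \<bullet> c + \<beta> a = (if c = a then 1 else 0)"
    by auto
  have "simplex_coords C N \<beta>" using C(1,2) dual by unfold_locales
  then show ?thesis using C(3) that by blast
qed

lemma simplex_compact_convex:
  fixes K :: "(real^'n) set"
  assumes "int CARD('n) simplex K"
  shows "compact K" "convex K"
proof -
  obtain C where C: "\<not> affine_dependent C" "K = convex hull C"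
    using assms by (auto simp: simplex_def)
  from C(1) have "compact C" by (intro finite_imp_compact aff_independent_finite)
  then show "compact K" "convex K"
    unfolding C(2) by (simp_all add: compact_convex_hull convex_convex_hull)
qed

lemma integrable_surface_measure:
  fixes K :: "(real^'n) set"
  assumes "int CARD('n) simplex K" "e facet_of K" "continuous_on e g"
  shows "integrable (surface_measure e) (g :: _ \<Rightarrow> real)"
  using assms by (metis simplex_coords_exist simplex_coords.facets simplex_coords.surface_integral_prism(1))

lemma facets_finite:
  fixes K :: "(real^'n) set"
  assumes "int CARD('n) simplex K"
  shows "finite {e. e facet_of K}"
proof -
  obtain C N \<beta> where C: "simplex_coords C N \<beta>" "K = convex hull C"
    using assms by (rule simplex_coords_exist)
  then have "{e. e facet_of K} = simplex_coords.facet C ` C"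
    by (auto simp: simplex_coords.facets)
  then show ?thesis using simplex_coords.finite_C[OF C(1)] by simp
qed

text \<open>
  The divergence theorem for the components of \<open>v F\<close>, summed over the coordinate directions.
\<close>

lemma green_simplex:
  fixes K :: "(real^'n) set" and F :: "real^'n \<Rightarrow> real^'n"
  assumes K: "int CARD('n) simplex K" and F: "C1_ext K F D" and v: "C1_ext K v E"
  shows "integral\<^sup>L (lebesgue_on (interior K)) (\<lambda>x. F x \<bullet> grad K v x)
       = (\<Sum>e | e facet_of K. \<integral>x. (F x \<bullet> face_normal K e) * v x \<partial>surface_measure e)
         - integral\<^sup>L (lebesgue_on (interior K)) (\<lambda>x. divg K F x * v x)"
proof -
  let ?L = "lebesgue_on (interior K)"
  note cc = simplex_compact_convex[OF K]
  note cont = C1_ext_D(2,3)[OF F] C1_ext_D(2,3)[OF v]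
  have integrable: "integrable ?L f" if f: "continuous_on K f" for f :: "real^'n \<Rightarrow> real"
  proof -
    have "bounded (f ` K)" using f cc by (simp add: compact_continuous_image compact_imp_bounded)
    then obtain B where "\<And>x. x \<in> K \<Longrightarrow> \<bar>f x\<bar> \<le> B" by (auto simp: bounded_iff)
    then show ?thesis
      using cc f interior_subset[of K]
      by (intro integrable_lebesgue_on_interior[where B=B] compact_imp_bounded
          continuous_imp_measurable_on_sets_lebesgue continuous_on_subset[OF f]) auto
  qed
  have gauss: "integral\<^sup>L ?L (\<lambda>x. v x * D x (axis i 1) $ i + E x (axis i 1) * F x $ i)
      = (\<Sum>e | e facet_of K. face_normal K e $ i * (\<integral>x. v x * F x $ i \<partial>surface_measure e))" for i
  proof -
    obtain C N \<beta> where C: "simplex_coords C N \<beta>" "K = convex hull C"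
      using K by (rule simplex_coords_exist)
    interpret simplex_coords C N \<beta> by (rule C)
    have ext: "C1_ext K (\<lambda>x. v x * F x $ i) (\<lambda>x h. v x * D x h $ i + E x h * F x $ i)"
      using C1_ext_scaleR[OF v C1_ext_component[OF F]] by simp
    note gauss_K = simplex_derivative_integral[folded C(2), OF C1_ext_D(1)[OF ext] C1_ext_D(2)[OF ext]]
    show ?thesis
      using gauss_K[of "axis i 1"]
      by (simp add: integral_lebesgue_on_interior_continuous[OF cc C1_ext_D(2)[OF ext]] inner_axis)
  qed
  have "integral\<^sup>L ?L (\<lambda>x. F x \<bullet> grad K v x) + integral\<^sup>L ?L (\<lambda>x. divg K F x * v x)
      = integral\<^sup>L ?L (\<lambda>x. \<Sum>i\<in>UNIV. F x $ i * E x (axis i 1)) +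
        integral\<^sup>L ?L (\<lambda>x. \<Sum>i\<in>UNIV. D x (axis i 1) $ i * v x)"
  proof -
    have "F x \<bullet> grad K v x = (\<Sum>i\<in>UNIV. F x $ i * E x (axis i 1))"
      "divg K F x * v x = (\<Sum>i\<in>UNIV. D x (axis i 1) $ i * v x)"
      if "x \<in> space ?L" for x
    proof -
      have "x \<in> interior K" using that by (simp add: space_restrict_space)
      then show "F x \<bullet> grad K v x = (\<Sum>i\<in>UNIV. F x $ i * E x (axis i 1))"
        "divg K F x * v x = (\<Sum>i\<in>UNIV. D x (axis i 1) $ i * v x)"
        by (simp_all add: grad_interior[OF v] divg_interior[OF F] inner_vec_def sum_distrib_right)
    qed
    then show ?thesis
      by (intro arg_cong2[where f="(+)"] Bochner_Integration.integral_cong refl)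
  qed
  also have "\<dots> = (\<Sum>i\<in>UNIV. integral\<^sup>L ?L (\<lambda>x. v x * D x (axis i 1) $ i + E x (axis i 1) * F x $ i))"
  proof -
    have parts: "integrable ?L (\<lambda>x. F x $ i * E x (axis i 1))" "integrable ?L (\<lambda>x. D x (axis i 1) $ i * v x)" for i
      by (intro integrable continuous_on_mult continuous_on_component cont)+
    have "integral\<^sup>L ?L (\<lambda>x. \<Sum>i\<in>UNIV. F x $ i * E x (axis i 1)) +
        integral\<^sup>L ?L (\<lambda>x. \<Sum>i\<in>UNIV. D x (axis i 1) $ i * v x)
      = (\<Sum>i\<in>UNIV. integral\<^sup>L ?L (\<lambda>x. F x $ i * E x (axis i 1))
                   + integral\<^sup>L ?L (\<lambda>x. D x (axis i 1) $ i * v x))"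
      by (simp only: Bochner_Integration.integral_sum[OF parts(1)] Bochner_Integration.integral_sum[OF parts(2)]
          sum.distrib)
    also have "\<dots> = (\<Sum>i\<in>UNIV. integral\<^sup>L ?L (\<lambda>x. v x * D x (axis i 1) $ i + E x (axis i 1) * F x $ i))"
    proof (rule sum.cong[OF refl])
      fix i :: 'n
      show "integral\<^sup>L ?L (\<lambda>x. F x $ i * E x (axis i 1)) + integral\<^sup>L ?L (\<lambda>x. D x (axis i 1) $ i * v x)
          = integral\<^sup>L ?L (\<lambda>x. v x * D x (axis i 1) $ i + E x (axis i 1) * F x $ i)"
        using Bochner_Integration.integral_add[OF parts] by (simp add: ac_simps)
    qed
    finally show ?thesis .
  qed
  also have "\<dots> = (\<Sum>e | e facet_of K. \<Sum>i\<in>UNIV. face_normal K e $ i * (\<integral>x. v x * F x $ i \<partial>surface_measure e))"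
    unfolding gauss by (rule sum.swap)
  also have "\<dots> = (\<Sum>e | e facet_of K. \<integral>x. (F x \<bullet> face_normal K e) * v x \<partial>surface_measure e)"
  proof (rule sum.cong[OF refl])
    fix e assume "e \<in> {e. e facet_of K}"
    then have e: "e facet_of K" by simp
    then have "e \<subseteq> K" by (simp add: facet_of_imp_subset)
    then have c: "continuous_on e v" "continuous_on e F"
      using cont by (auto intro: continuous_on_subset)
    have "integrable (surface_measure e) (\<lambda>x. v x * F x $ i)" for i
      by (rule integrable_surface_measure[OF K e]) (intro continuous_intros c)
    then have "(\<Sum>i\<in>UNIV. face_normal K e $ i * (\<integral>x. v x * F x $ i \<partial>surface_measure e))
        = (\<integral>x. (\<Sum>i\<in>UNIV. face_normal K e $ i * (v x * F x $ i)) \<partial>surface_measure e)"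
      by (subst Bochner_Integration.integral_sum) auto
    also have "\<dots> = (\<integral>x. (F x \<bullet> face_normal K e) * v x \<partial>surface_measure e)"
      by (simp add: inner_vec_def sum_distrib_right sum_distrib_left ac_simps)
    finally show "(\<Sum>i\<in>UNIV. face_normal K e $ i * (\<integral>x. v x * F x $ i \<partial>surface_measure e))
        = (\<integral>x. (F x \<bullet> face_normal K e) * v x \<partial>surface_measure e)" .
  qed
  finally show ?thesis by simp
qed

section \<open>Invertibility of the dispersion tensor\<close>

text \<open>
  The tensor is positive definite: \<open>E\<close> is the orthogonal projection onto the line of \<open>w\<close> (or 0 if
  \<open>w = 0\<close>), so the term with \<open>d\<^sub>l\<close> and \<open>d\<^sub>t\<close> is positive semidefinite and the molecular part with
  \<open>d\<^sub>m\<close> makes the quadratic form definite.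
\<close>

lemma dispersion_inverse:
  fixes w g :: "real^'n"
  assumes "d\<^sub>m > 0" "d\<^sub>l \<ge> 0" "d\<^sub>t \<ge> 0" "\<phi> > 0"
  shows "matrix_inv (dispersion d\<^sub>m d\<^sub>l d\<^sub>t \<phi> w) *v (dispersion d\<^sub>m d\<^sub>l d\<^sub>t \<phi> w *v g) = g"
proof -
  let ?D = "dispersion d\<^sub>m d\<^sub>l d\<^sub>t \<phi> w"
  define E :: "real^'n^'n" where "E = (\<chi> i j. w $ i * w $ j / (norm w)\<^sup>2)"
  have E: "E *v x = ((w \<bullet> x) / (norm w)\<^sup>2) *\<^sub>R w" for x
    by (simp add: E_def vec_eq_iff matrix_vector_mult_def inner_vec_def sum_distrib_left sum_divide_distrib ac_simps)
  have D: "?D *v x = \<phi> *\<^sub>R (d\<^sub>m *\<^sub>R x + norm w *\<^sub>R (d\<^sub>l *\<^sub>R (E *v x) + d\<^sub>t *\<^sub>R (x - E *v x)))" for x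
    unfolding dispersion_def Let_def E_def[symmetric]
    by (simp add: scaleR_matrix_vector_assoc[symmetric] matrix_vector_mult_add_rdistrib
        matrix_vector_mult_diff_rdistrib)
  have "x = 0" if x: "?D *v x = 0" for x
  proof -
    define s where "s = (w \<bullet> x)\<^sup>2 / (norm w)\<^sup>2"
    have s: "0 \<le> s" "s \<le> (norm x)\<^sup>2"
    proof -
      have "(w \<bullet> x)\<^sup>2 \<le> (norm w * norm x)\<^sup>2"
        using Cauchy_Schwarz_ineq2[of w x] by (metis abs_ge_zero power2_abs power_mono)
      then show "s \<le> (norm x)\<^sup>2"
        by (cases "w = 0") (simp_all add: s_def field_simps power_mult_distrib)
    qed (simp add: s_def)
    have "x \<bullet> (?D *v x) = \<phi> * (d\<^sub>m * (norm x)\<^sup>2 + norm w * (d\<^sub>l * s + d\<^sub>t * ((norm x)\<^sup>2 - s)))"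
      unfolding D E s_def
      by (simp add: inner_add_right inner_diff_right dot_square_norm inner_commute power2_eq_square)
    moreover have "norm w * (d\<^sub>l * s + d\<^sub>t * ((norm x)\<^sup>2 - s)) \<ge> 0"
      using assms s by simp
    ultimately have "d\<^sub>m * (norm x)\<^sup>2 \<le> 0"
      using x assms(4) by simp
    then show "x = 0" using assms(1) by (simp add: mult_le_0_iff)
  qed
  then have "\<exists>B. B ** ?D = mat 1"
    by (subst matrix_left_invertible_ker) blast
  then have "invertible ?D" by (simp add: invertible_left_inverse)
  then have "matrix_inv ?D ** ?D = mat 1"
    unfolding invertible_def matrix_inv_def by (rule someI2_ex) simp
  then show ?thesis by (simp add: matrix_vector_mul_assoc)
qed

section \<open>Facets in a triangulation\<close>

lemma norm_face_normal:
  fixes K :: "(real^'n) set"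
  assumes "int CARD('n) simplex K" "e facet_of K"
  shows "norm (face_normal K e) = 1"
proof -
  obtain C N \<beta> where C: "simplex_coords C N \<beta>" "K = convex hull C"
    using assms(1) by (rule simplex_coords_exist)
  interpret simplex_coords C N \<beta> by (rule C)
  obtain a where a: "a \<in> C" "e = facet a" using assms(2) C(2) facets by auto
  then show ?thesis using N_nonzero[OF a(1)] by (simp add: C(2) face_normal_facet)
qed

lemma face_normal_orthogonal:
  fixes K :: "(real^'n) set"
  assumes "int CARD('n) simplex K" "e facet_of K" "x \<in> e" "y \<in> e"
  shows "face_normal K e \<bullet> (y - x) = 0"
proof -
  obtain C N \<beta> where C: "simplex_coords C N \<beta>" "K = convex hull C"
    using assms(1) by (rule simplex_coords_exist)
  interpret simplex_coords C N \<beta> by (rule C)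
  obtain a where a: "a \<in> C" "e = facet a" using assms(2) C(2) facets by auto
  then show ?thesis using assms(3,4)
    by (simp add: C(2) face_normal_facet mem_facet_iff bary_diff)
qed

lemma face_normal_unique_up_to_sign:
  fixes K :: "(real^'n) set"
  assumes K: "int CARD('n) simplex K" "e facet_of K"
    and K': "int CARD('n) simplex K'" "e facet_of K'"
  shows "face_normal K' e = face_normal K e \<or> face_normal K' e = - face_normal K e"
proof -
  obtain C N \<beta> where C: "simplex_coords C N \<beta>" "K = convex hull C"
    using K(1) by (rule simplex_coords_exist)
  interpret simplex_coords C N \<beta> by (rule C)
  obtain a where a: "a \<in> C" "e = facet a" using K(2) C(2) facets by auto
  obtain z where z: "z \<in> facet a" using facet_nonempty[OF a(1)] by blast
  define t where "t = face_normal K' e \<bullet> (a - z)"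
  have t: "face_normal K' e = t *\<^sub>R N a"
    unfolding t_def
    by (rule orthogonal_to_facet[OF a(1) _ z]) (use face_normal_orthogonal[OF K'] a in auto)
  then have "\<bar>t\<bar> * norm (N a) = 1" using norm_face_normal[OF K'] by simp
  then have "t = 1 / norm (N a) \<or> t = - (1 / norm (N a))"
    using N_nonzero[OF a(1)] by (cases "t \<ge> 0") (auto simp: field_simps)
  moreover have "face_normal K e = - (1 / norm (N a)) *\<^sub>R N a"
    unfolding C(2) a(2) by (rule face_normal_facet[OF a(1)])
  ultimately show ?thesis using t by auto
qed

text \<open>
  At a relative interior point of a facet the barycentric coordinates of all vertices of the facet are
  positive, hence also nearby; only the inequality for the opposite vertex remains.
\<close>

lemma simplex_half_ball:
  fixes K :: "(real^'n) set"
  assumes K: "int CARD('n) simplex K" "e facet_of K" and x: "x \<in> rel_interior e"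
  obtains r where "r > 0" "\<And>y. y \<in> ball x r \<Longrightarrow> y \<in> K \<longleftrightarrow> face_normal K e \<bullet> (y - x) \<le> 0"
proof -
  obtain C N \<beta> where C: "simplex_coords C N \<beta>" "K = convex hull C"
    using K(1) by (rule simplex_coords_exist)
  interpret simplex_coords C N \<beta> by (rule C)
  obtain a where a: "a \<in> C" "e = facet a" using K(2) C(2) facets by auto
  have "x \<in> e" using x rel_interior_subset by blast
  then have ax: "bary a x = 0" using a by (simp add: mem_facet_iff)
  have "rel_interior e = {y. \<exists>u. (\<forall>c\<in>C - {a}. 0 < u c) \<and> sum u (C - {a}) = 1 \<and>
      (\<Sum>c\<in>C - {a}. u c *\<^sub>R c) = y}"
    unfolding a(2) facet_def
    by (rule rel_interior_convex_hull_explicit) (rule affine_independent_Diff[OF indep])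
  then obtain u where u: "\<forall>c\<in>C - {a}. 0 < u c" "sum u (C - {a}) = 1"
      "(\<Sum>c\<in>C - {a}. u c *\<^sub>R c) = x"
    using x by auto
  \<comment> \<open>extending the weights by 0 at the opposite vertex makes them the barycentric coordinates of \<open>x\<close>\<close>
  define v where "v = u(a := 0)"
  have v: "sum v C = 1" "(\<Sum>c\<in>C. v c *\<^sub>R c) = x"
    using u(2,3) a finite_C by (auto simp: v_def sum.remove)
  have pos: "0 < bary c x" if "c \<in> C - {a}" for c
    using bary_combination[of c v] v u(1) that by (auto simp: v_def)
  have "open (\<Inter>c\<in>C - {a}. {y. 0 < bary c y})"
    using finite_C by (intro open_INT) (auto intro!: open_Collect_less continuous_bary)
  moreover have "x \<in> (\<Inter>c\<in>C - {a}. {y. 0 < bary c y})" using pos by auto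
  ultimately obtain r where r: "r > 0" "ball x r \<subseteq> (\<Inter>c\<in>C - {a}. {y. 0 < bary c y})"
    by (meson open_contains_ball)
  have "y \<in> K \<longleftrightarrow> face_normal K e \<bullet> (y - x) \<le> 0" if "y \<in> ball x r" for y
  proof -
    have "\<forall>c\<in>C - {a}. 0 < bary c y" using r(2) that by blast
    then have "y \<in> K \<longleftrightarrow> 0 \<le> bary a y"
      using a(1) by (auto simp: C(2) mem_simplex_iff intro: less_imp_le)
    also have "\<dots> \<longleftrightarrow> face_normal K e \<bullet> (y - x) \<le> 0"
      using N_nonzero[OF a(1)]
      by (simp add: C(2) a(2) face_normal_facet[OF a(1)] bary_diff ax zero_le_divide_iff)
    finally show ?thesis .
  qed
  then show ?thesis using r(1) that by blast
qed

lemma full_simplex_face_eq: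
  fixes K :: "(real^'n) set"
  assumes K: "int CARD('n) simplex K" "int CARD('n) simplex K'" and face: "K face_of K'"
  shows "K = K'"
proof (rule ccontr)
  assume "K \<noteq> K'"
  then have "aff_dim K < aff_dim K'"
    using face_of_aff_dim_lt[OF simplex_compact_convex(2)[OF K(2)] face] by blast
  then show False using K by (simp add: aff_dim_simplex)
qed

lemma triangulation_Int_face:
  assumes "triangulation \<T>" "K \<in> \<T>" "K' \<in> \<T>"
  shows "K \<inter> K' face_of K" "K \<inter> K' face_of K'"
  using assms by (simp add: triangulation_def) (metis assms Int_commute triangulation_def)

text \<open>
  If the normals agreed, both elements would contain the same half ball at a relative interior point
  of the facet.  Their intersection, a common face, would then meet the interior of both, so it would be equal to both.
\<close>

lemma opposite_face_normals:
  fixes K :: "(real^'n) set"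
  assumes T: "triangulation \<T>" and full: "\<And>K. K \<in> \<T> \<Longrightarrow> int CARD('n) simplex K"
    and K: "K \<in> \<T>" "K' \<in> \<T>" "K \<noteq> K'" and e: "e facet_of K" "e facet_of K'"
  shows "face_normal K' e = - face_normal K e"
proof (rule ccontr)
  assume "face_normal K' e \<noteq> - face_normal K e"
  then have eq: "face_normal K' e = face_normal K e"
    using face_normal_unique_up_to_sign[OF full[OF K(1)] e(1) full[OF K(2)] e(2)] by blast
  let ?\<nu> = "face_normal K e"
  have n: "norm ?\<nu> = 1" using norm_face_normal[OF full[OF K(1)] e(1)] .
  have "convex e" "e \<noteq> {}"
    using e(1) by (auto simp: facet_of_def face_of_imp_convex)
  then obtain x where x: "x \<in> rel_interior e" using rel_interior_eq_empty by blast
  obtain r where r: "r > 0" "\<And>y. y \<in> ball x r \<Longrightarrow> y \<in> K \<longleftrightarrow> ?\<nu> \<bullet> (y - x) \<le> 0"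
    using simplex_half_ball[OF full[OF K(1)] e(1) x] by blast
  obtain r' where r': "r' > 0" "\<And>y. y \<in> ball x r' \<Longrightarrow> y \<in> K' \<longleftrightarrow> ?\<nu> \<bullet> (y - x) \<le> 0"
    using simplex_half_ball[OF full[OF K(2)] e(2) x] unfolding eq by blast
  define U where "U = ball x (min r r') \<inter> {y. ?\<nu> \<bullet> y < ?\<nu> \<bullet> x}"
  \<comment> \<open>moving from \<open>x\<close> against the normal by half the radius leads into both half balls\<close>
  define s where "s = min r r' / 2"
  have s: "0 < s" "s < min r r'" using r(1) r'(1) by (auto simp: s_def)
  have U: "open U" "U \<subseteq> K" "U \<subseteq> K'"
    using r(2) r'(2) by (auto simp: U_def inner_diff_right open_halfspace_lt less_imp_le)
  moreover have "x - s *\<^sub>R ?\<nu> \<in> U"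
    using s n by (auto simp: U_def dist_norm inner_diff_right dot_square_norm)
  ultimately obtain y where y: "y \<in> interior K" "y \<in> interior K'" "y \<in> K \<inter> K'"
    using interior_maximal by blast
  then have ri: "y \<in> rel_interior K" "y \<in> rel_interior K'"
    using interior_subset_rel_interior by blast+
  have "K \<inter> K' face_of K" "K \<inter> K' face_of K'"
    using triangulation_Int_face[OF T K(1,2)] .
  then have "K \<inter> K' = K" "K \<inter> K' = K'"
    using face_of_disjoint_rel_interior ri y(3) by blast+
  then show False using K(3) by auto
qed

text \<open>
  The face \<open>K \<inter> K'\<close> meets the relative interior of \<open>e\<close>, so it contains \<open>e\<close>; being a proper face of \<open>K\<close>, it
  has no larger dimension than \<open>e\<close>, so it is \<open>e\<close>.
\<close>

lemma shared_facet:
  fixes K :: "(real^'n) set"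
  assumes T: "triangulation \<T>" and full: "\<And>K. K \<in> \<T> \<Longrightarrow> int CARD('n) simplex K"
    and K: "K \<in> \<T>" "K' \<in> \<T>" "K \<noteq> K'" and e: "e facet_of K"
    and x: "x \<in> rel_interior e" "x \<in> K'"
  shows "e facet_of K'"
proof -
  let ?I = "K \<inter> K'"
  have I: "?I face_of K" "?I face_of K'"
    using triangulation_Int_face[OF T K(1,2)] .
  have eK: "e \<subseteq> K" "e face_of K" using e by (auto simp: facet_of_def face_of_imp_subset)
  have "?I \<inter> rel_interior e \<noteq> {}" using x eK rel_interior_subset by blast
  then have sub: "e \<subseteq> ?I" using subset_of_face_of[OF I(1) eK(1)] by blast
  have dims: "aff_dim K = CARD('n)" "aff_dim K' = CARD('n)"
    using full K by (auto simp: aff_dim_simplex)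
  have "?I \<noteq> K" using I(2) K full_simplex_face_eq[OF full full] by metis
  then have "aff_dim ?I < aff_dim K"
    using face_of_aff_dim_lt[OF simplex_compact_convex(2)[OF full[OF K(1)]] I(1)] by blast
  moreover have "e face_of ?I" using eK(2) sub by (rule face_of_subset) auto
  moreover have "convex ?I" using I(1) by (rule face_of_imp_convex)
  ultimately have "e = ?I"
    using face_of_aff_dim_lt[of ?I e] e by (cases "e = ?I") (simp_all add: facet_of_def)
  then show ?thesis using e I(2) dims by (simp add: facet_of_def)
qed

locale simplicial_mesh =
  fixes \<Omega> :: "(real^'n) set" and \<T> :: "(real^'n) set set"
  assumes open_domain: "open \<Omega>" and regular: "interior (closure \<Omega>) = \<Omega>"
    and bounded_domain: "bounded \<Omega>"
    and tri: "triangulation \<T>" and simplices: "\<And>K. K \<in> \<T> \<Longrightarrow> int CARD('n) simplex K"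
    and cover: "\<Union>\<T> = closure \<Omega>"
begin

text \<open>
  By \<open>shared_facet\<close> no other element contains \<open>x\<close>, so near \<open>x\<close> the closure of the domain is the
  element \<open>K\<close>, that is, a half ball.  The regularity of the domain turns this into a description of
  the domain itself.
\<close>

lemma boundary_facet_normal:
  assumes K: "K \<in> \<T>" "e facet_of K"
    and only: "\<And>K'. K' \<in> \<T> \<Longrightarrow> e facet_of K' \<Longrightarrow> K' = K"
    and x: "x \<in> rel_interior e"
  shows "x \<in> frontier \<Omega>" "domain_normal \<Omega> x (face_normal K e)"
proof -
  let ?\<nu> = "face_normal K e"
  have n: "norm ?\<nu> = 1" using norm_face_normal[OF simplices[OF K(1)] K(2)] .
  obtain r where r: "r > 0" "\<And>y. y \<in> ball x r \<Longrightarrow> y \<in> K \<longleftrightarrow> ?\<nu> \<bullet> (y - x) \<le> 0"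
    using simplex_half_ball[OF simplices[OF K(1)] K(2) x] by blast
  have "closed (\<Union>(\<T> - {K}))"
    using tri simplex_compact_convex(1)[OF simplices]
    by (intro closed_Union) (auto simp only: triangulation_def compact_imp_closed finite_Diff Diff_iff)
  moreover have "x \<notin> \<Union>(\<T> - {K})"
  proof
    assume "x \<in> \<Union>(\<T> - {K})"
    then obtain K' where K': "K' \<in> \<T>" "K \<noteq> K'" "x \<in> K'" by blast
    have "e facet_of K'" using shared_facet[OF tri simplices K(1) K'(1,2) K(2) x K'(3)] .
    then show False using only[OF K'(1)] K'(2) by simp
  qed
  ultimately obtain r' where r': "r' > 0" "ball x r' \<subseteq> - \<Union>(\<T> - {K})"
    by (metis ComplI open_Compl open_contains_ball)
  define \<rho> where "\<rho> = min r r'"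
  have "y \<in> closure \<Omega> \<longleftrightarrow> ?\<nu> \<bullet> (y - x) \<le> 0" if "y \<in> ball x \<rho>" for y
  proof -
    have "y \<notin> \<Union>(\<T> - {K})" using that r'(2) by (auto simp: \<rho>_def)
    then have "y \<in> closure \<Omega> \<longleftrightarrow> y \<in> K"
      unfolding cover[symmetric] using K(1) by blast
    then show ?thesis using r(2)[of y] that by (simp add: \<rho>_def)
  qed
  then have "closure \<Omega> \<inter> ball x \<rho> = {y. ?\<nu> \<bullet> y \<le> ?\<nu> \<bullet> x} \<inter> ball x \<rho>"
    by (auto simp: inner_diff_right)
  then have "interior (closure \<Omega>) \<inter> interior (ball x \<rho>)
      = interior {y. ?\<nu> \<bullet> y \<le> ?\<nu> \<bullet> x} \<inter> interior (ball x \<rho>)"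
    by (metis interior_Int)
  moreover have "interior {y. ?\<nu> \<bullet> y \<le> ?\<nu> \<bullet> x} = {y. ?\<nu> \<bullet> y < ?\<nu> \<bullet> x}"
    using n by (intro interior_halfspace_le) auto
  ultimately have "\<Omega> \<inter> ball x \<rho> = {y. ?\<nu> \<bullet> y < ?\<nu> \<bullet> x} \<inter> ball x \<rho>"
    by (simp only: regular interior_ball)
  then have local: "\<Omega> \<inter> ball x \<rho> = {y \<in> ball x \<rho>. ?\<nu> \<bullet> (y - x) < 0}"
    by (simp only: inner_diff_right less_iff_diff_less_0[symmetric]) blast
  have \<rho>: "\<rho> > 0" using r(1) r'(1) by (simp add: \<rho>_def)
  then show "domain_normal \<Omega> x ?\<nu>"
    using n local by (auto simp: domain_normal_def)
  have "x \<in> K" using x rel_interior_subset facet_of_imp_subset[OF K(2)] by blast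
  then have "x \<in> closure \<Omega>" using K(1) cover by blast
  moreover have "x \<notin> \<Omega>"
  proof
    assume "x \<in> \<Omega>"
    then have "x \<in> \<Omega> \<inter> ball x \<rho>" using \<rho> by simp
    then show False unfolding local by simp
  qed
  ultimately show "x \<in> frontier \<Omega>" using open_domain by (simp add: frontier_def interior_open)
qed

text \<open>
  The integrals are grouped by faces.  On a face of a single element the flux vanishes at relative
  interior points by the boundary condition, and by continuity on the whole face.  On a
  face of two elements the integrals are negatives of each other; a third element is impossible, since
  its normal would have to be opposite to both.
\<close>

lemma normal_flux_cancels:
  fixes F :: "real^'n \<Rightarrow> real^'n"
  assumes F: "continuous_on (closure \<Omega>) F"
    and no_flow: "\<And>x \<nu>. x \<in> frontier \<Omega> \<Longrightarrow> domain_normal \<Omega> x \<nu> \<Longrightarrow> F x \<bullet> \<nu> = 0"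
  shows "bdry_inner \<T> (\<lambda>K e x. F x \<bullet> face_normal K e) (\<lambda>K e. m e) = 0"
proof -
  let ?I = "\<lambda>K e. \<integral>x. (F x \<bullet> face_normal K e) * m e x \<partial>surface_measure e"
  have fin: "finite \<T>" using tri by (simp add: triangulation_def)
  have faces: "mesh_faces \<T> = (\<Union>K\<in>\<T>. {e. e facet_of K})" by (auto simp: mesh_faces_def)
  have fin': "finite (mesh_faces \<T>)"
    unfolding faces using fin facets_finite[OF simplices] by blast
  have "bdry_inner \<T> (\<lambda>K e x. F x \<bullet> face_normal K e) (\<lambda>K e. m e)
      = (\<Sum>K\<in>\<T>. \<Sum>e | e \<in> mesh_faces \<T> \<and> e facet_of K. ?I K e)"
    unfolding bdry_inner_def by (intro sum.cong refl arg_cong2[where f=sum]) (auto simp: mesh_faces_def)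
  also have "\<dots> = (\<Sum>e\<in>mesh_faces \<T>. \<Sum>K | K \<in> \<T> \<and> e facet_of K. ?I K e)"
    by (rule sum.swap_restrict[OF fin fin'])
  also have "\<dots> = 0"
  proof (rule sum.neutral, rule ballI)
    fix e assume "e \<in> mesh_faces \<T>"
    then obtain K where K: "K \<in> \<T>" "e facet_of K" by (auto simp: mesh_faces_def)
    show "(\<Sum>K | K \<in> \<T> \<and> e facet_of K. ?I K e) = 0"
    proof (cases "\<exists>K'\<in>\<T>. e facet_of K' \<and> K' \<noteq> K")
      case True
      then obtain K' where K': "K' \<in> \<T>" "e facet_of K'" "K' \<noteq> K" by blast
      have opp: "face_normal B e = - face_normal A e"
        if "A \<in> \<T>" "B \<in> \<T>" "A \<noteq> B" "e facet_of A" "e facet_of B" for A B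
        using opposite_face_normals[OF tri simplices that] .
      have n: "face_normal K' e = - face_normal K e"
        using opp[OF K(1) K'(1) _ K(2) K'(2)] K'(3) by blast
      have "K'' = K \<or> K'' = K'" if K'': "K'' \<in> \<T>" "e facet_of K''" for K''
      proof (rule ccontr)
        assume "\<not> (K'' = K \<or> K'' = K')"
        then have "K \<noteq> K''" "K' \<noteq> K''" by auto
        then have "face_normal K'' e = - face_normal K e" "face_normal K'' e = - face_normal K' e"
          using opp[OF K(1) K''(1) _ K(2) K''(2)] opp[OF K'(1) K''(1) _ K'(2) K''(2)] by blast+
        then have "face_normal K e = - face_normal K e" using n by simp
        then have "face_normal K e \<bullet> face_normal K e = - (face_normal K e \<bullet> face_normal K e)"
          by (metis inner_minus_left)
        then show False using norm_face_normal[OF simplices[OF K(1)] K(2)] by (simp add: dot_square_norm)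
      qed
      then have "{K \<in> \<T>. e facet_of K} = {K, K'}" using K K' by auto
      then show ?thesis using K'(3) by (simp add: n)
    next
      case False
      then have only: "\<And>K'. K' \<in> \<T> \<Longrightarrow> e facet_of K' \<Longrightarrow> K' = K" by blast
      have eK: "e \<subseteq> K" "convex e"
        using K(2) by (auto simp: facet_of_def face_of_imp_subset face_of_imp_convex)
      have "closed e"
        using K(2) simplex_compact_convex[OF simplices[OF K(1)]]
        by (auto simp: facet_of_def intro: face_of_imp_closed compact_imp_closed)
      have "F x \<bullet> face_normal K e = 0" if "x \<in> e" for x
      proof (rule continuous_constant_on_closure[where S="rel_interior e" and f="\<lambda>x. F x \<bullet> face_normal K e"])
        have cl: "closure (rel_interior e) = e"
          using eK(2) \<open>closed e\<close> by (simp add: convex_closure_rel_interior closure_closed)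
        show "continuous_on (closure (rel_interior e)) (\<lambda>x. F x \<bullet> face_normal K e)"
          unfolding cl using eK(1) K(1) cover
          by (intro continuous_intros continuous_on_subset[OF F]) blast
        show "x \<in> closure (rel_interior e)" using that cl by simp
        fix y assume "y \<in> rel_interior e"
        then show "F y \<bullet> face_normal K e = 0"
          using no_flow[OF boundary_facet_normal[OF K only]] by simp
      qed
      then have "?I K e = (\<integral>x. 0 \<partial>surface_measure e)"
        by (intro Bochner_Integration.integral_cong)
          (auto simp: surface_measure_def Let_def space_restrict_space)
      moreover have "{K \<in> \<T>. e facet_of K} = {K}" using K only by blast
      ultimately show ?thesis by simp
    qed
  qed
  finally show ?thesis .
qed

section \<open>Consistency of the flow and transport equations\<close>

lemma element_subset: "K \<in> \<T> \<Longrightarrow> K \<subseteq> closure \<Omega>"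
  using cover by blast

lemma interior_element_subset: "K \<in> \<T> \<Longrightarrow> interior K \<subseteq> \<Omega>"
  using interior_mono[OF element_subset] regular by blast

lemma vol_inner_interior:
  "vol_inner \<T> f g = (\<Sum>K\<in>\<T>. integral\<^sup>L (lebesgue_on (interior K)) (\<lambda>x. f K x \<bullet> g K x))"
  unfolding vol_inner_def
  by (intro sum.cong refl integral_lebesgue_on_interior simplex_compact_convex simplices)

lemma vol_inner_cong:
  assumes "\<And>K x. K \<in> \<T> \<Longrightarrow> x \<in> interior K \<Longrightarrow> f K x \<bullet> g K x = f' K x \<bullet> g' K x"
  shows "vol_inner \<T> f g = vol_inner \<T> f' g'"
  unfolding vol_inner_interior
  by (intro sum.cong refl Bochner_Integration.integral_cong)
    (auto simp: space_restrict_space assms)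

text \<open>
  Integrability on the interiors of the elements.  The exact equations hold only in the open domain,
  and all integrals over elements are evaluated there.
\<close>

definition integrable_product where
  "integrable_product f g \<longleftrightarrow>
     (\<forall>K\<in>\<T>. integrable (lebesgue_on (interior K)) (\<lambda>x. f K x \<bullet> g K x))"

lemma vol_inner_add:
  assumes "integrable_product f g" "integrable_product f' g"
  shows "vol_inner \<T> f g + vol_inner \<T> f' g = vol_inner \<T> (\<lambda>K x. f K x + f' K x) g"
  unfolding vol_inner_interior sum.distrib[symmetric] inner_add_left
  using assms by (intro sum.cong refl Bochner_Integration.integral_add[symmetric])
    (auto simp: integrable_product_def)

lemma vol_inner_scale:
  fixes f g :: "('n, real) broken"
  shows "vol_inner \<T> (\<lambda>K x. r * f K x) g = r * vol_inner \<T> f g"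
  by (simp add: vol_inner_def sum_distrib_left mult.assoc)

lemma integrable_product_scale:
  fixes f g :: "('n, real) broken"
  shows "integrable_product f g \<Longrightarrow> integrable_product (\<lambda>K x. r * f K x) g"
  by (simp add: integrable_product_def mult.assoc)

lemma integrable_product_add:
  "integrable_product f g \<Longrightarrow> integrable_product f' g \<Longrightarrow>
    integrable_product (\<lambda>K x. f K x + f' K x) g"
  by (simp add: integrable_product_def inner_add_left)

text \<open>
  The weights are the porosity and the inverse of the permeability, which are only measurable and
  bounded.
\<close>

lemma integrable_product_weighted:
  assumes w: "w \<in> borel_measurable (lebesgue_on \<Omega>)" "\<And>x. x \<in> \<Omega> \<Longrightarrow> \<bar>w x\<bar> \<le> B"
    and f: "\<And>K. K \<in> \<T> \<Longrightarrow> continuous_on K (f K)"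
    and g: "\<And>K. K \<in> \<T> \<Longrightarrow> continuous_on K (g K)"
  shows "integrable_product (\<lambda>K x. w x *\<^sub>R f K x) g"
  unfolding integrable_product_def
proof
  fix K assume K: "K \<in> \<T>"
  let ?h = "\<lambda>x. f K x \<bullet> g K x"
  have comp: "compact K" using simplex_compact_convex(1)[OF simplices[OF K]] .
  have cont: "continuous_on K ?h" using f[OF K] g[OF K] by (rule continuous_on_inner)
  then have "bounded (?h ` K)" using comp by (simp add: compact_continuous_image compact_imp_bounded)
  then obtain H where H: "\<And>x. x \<in> K \<Longrightarrow> \<bar>?h x\<bar> \<le> H" by (auto simp: bounded_iff)
  have "w \<in> borel_measurable (restrict_space (lebesgue_on \<Omega>) (interior K))"
    using w(1) by (rule measurable_restrict_space1)
  moreover have "restrict_space (lebesgue_on \<Omega>) (interior K) = lebesgue_on (interior K)"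
    using interior_element_subset[OF K] open_domain
    by (subst restrict_restrict_space) (auto simp: Int_absorb1)
  ultimately have wm: "w \<in> borel_measurable (lebesgue_on (interior K))" by simp
  have hm: "?h \<in> borel_measurable (lebesgue_on (interior K))"
    by (rule continuous_imp_measurable_on_sets_lebesgue)
      (auto intro: continuous_on_subset[OF cont interior_subset])
  have "integrable (lebesgue_on (interior K)) (\<lambda>x. w x * ?h x)"
  proof (rule integrable_lebesgue_on_interior)
    show "bounded K" using comp by (rule compact_imp_bounded)
    show "(\<lambda>x. w x * ?h x) \<in> borel_measurable (lebesgue_on (interior K))"
      using wm hm by (rule borel_measurable_times)
    fix x assume x: "x \<in> interior K"
    then have "x \<in> \<Omega>" "x \<in> K" using interior_element_subset[OF K] interior_subset by blast+
    then show "\<bar>w x * ?h x\<bar> \<le> B * H"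
      using w(2) H unfolding abs_mult by (intro mult_mono) (auto intro: order_trans[OF abs_ge_zero])
  qed
  then show "integrable (lebesgue_on (interior K)) (\<lambda>x. (w x *\<^sub>R f K x) \<bullet> g K x)" by simp
qed

lemma integrable_product_continuous:
  assumes "\<And>K. K \<in> \<T> \<Longrightarrow> continuous_on K (f K)" "\<And>K. K \<in> \<T> \<Longrightarrow> continuous_on K (g K)"
  shows "integrable_product f g"
  using integrable_product_weighted[of "\<lambda>x. 1" 1, OF _ _ assms] by simp

lemma integrable_product_cong:
  assumes "\<And>K x. K \<in> \<T> \<Longrightarrow> x \<in> interior K \<Longrightarrow> f K x \<bullet> g K x = f' K x \<bullet> g' K x"
    and "integrable_product f' g'"
  shows "integrable_product f g"
  using assms(2) unfolding integrable_product_def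
  by (intro ballI, subst Bochner_Integration.integrable_cong[OF refl])
    (auto simp: space_restrict_space assms(1))

lemma continuous_on_element:
  "continuous_on (closure \<Omega>) f \<Longrightarrow> K \<in> \<T> \<Longrightarrow> continuous_on K f"
  by (rule continuous_on_subset[OF _ element_subset])

lemma Lambda_h_C1: "v \<in> Lambda_h k \<T> \<Longrightarrow> K \<in> \<T> \<Longrightarrow> \<exists>E. C1_ext K (v K) E"
  unfolding Lambda_h_def by (blast intro: poly_space_C1_ext)

lemma Lambda_h_continuous: "v \<in> Lambda_h k \<T> \<Longrightarrow> K \<in> \<T> \<Longrightarrow> continuous_on K (v K)"
  using Lambda_h_C1 C1_ext_D(3) by blast

lemma Sigma_h_continuous:
  assumes "m \<in> Sigma_h k \<T>" "K \<in> \<T>" "e facet_of K"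
  shows "continuous_on e (m e)"
proof -
  have "m e \<in> poly_space k e"
    using assms by (auto simp: Sigma_h_def mesh_faces_def)
  then show ?thesis using poly_space_C1_ext C1_ext_D(3) by blast
qed

lemma Theta_h_continuous:
  assumes "\<tau> \<in> Theta_h k \<T>" "K \<in> \<T>"
  shows "continuous_on K (\<tau> K)"
proof -
  obtain a b where a: "\<And>i. a i \<in> poly_space k K" and b: "b \<in> poly_space k K"
    and \<tau>: "\<And>x. x \<in> K \<Longrightarrow> \<tau> K x = (\<chi> i. a i x) + b x *\<^sub>R x"
  proof -
    have "\<tau> K \<in> RT_space k K" using assms by (simp add: Theta_h_def)
    then show ?thesis using that unfolding RT_space_def by blast
  qed
  have poly: "continuous_on K f" if "f \<in> poly_space k K" for f
    using poly_space_C1_ext[OF that] C1_ext_D(3) by blast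
  have "continuous_on K (\<lambda>x. (\<chi> i. a i x) + b x *\<^sub>R x)"
    by (intro continuous_intros continuous_on_vec_lambda poly a b)
  then show ?thesis using \<tau> by (simp cong: continuous_on_cong)
qed

lemma divg_element:
  assumes "C1_ext (closure \<Omega>) F D" "K \<in> \<T>" "x \<in> interior K"
  shows "divg (closure \<Omega>) F x = (\<Sum>i\<in>UNIV. D x (axis i 1) $ i)"
  using divg_interior[OF assms(1)] interior_element_subset[OF assms(2)] assms(3) regular by auto

text \<open>
  The common part of both equations of the scheme: \<open>green_simplex\<close> turns the element terms into
  \<open>-(div F, v)\<close> and face integrals against \<open>v\<close>; these cancel against the face terms with \<open>v\<close>, and the
  face terms with \<open>m\<close> vanish by \<open>normal_flux_cancels\<close>.
\<close>

lemma conservation_law_consistent: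
  assumes F: "C1_ext (closure \<Omega>) F D"
    and no_flow: "\<And>x \<nu>. x \<in> frontier \<Omega> \<Longrightarrow> domain_normal \<Omega> x \<nu> \<Longrightarrow> F x \<bullet> \<nu> = 0"
    and v: "v \<in> Lambda_h k \<T>" and m: "m \<in> Sigma_h k \<T>"
  shows "vol_inner \<T> (\<lambda>K. F) (\<lambda>K. grad K (v K))
       + bdry_inner \<T> (\<lambda>K e x. F x \<bullet> face_normal K e) (\<lambda>K e x. m e x - v K x)
       = - vol_inner \<T> (\<lambda>K. divg (closure \<Omega>) F) v"
proof -
  let ?Iv = "\<lambda>K e. \<integral>x. (F x \<bullet> face_normal K e) * v K x \<partial>surface_measure e"
  let ?Im = "\<lambda>K e. \<integral>x. (F x \<bullet> face_normal K e) * m e x \<partial>surface_measure e"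
  have contF: "continuous_on (closure \<Omega>) F" using F by (rule C1_ext_D)
  have split: "(\<integral>x. (F x \<bullet> face_normal K e) * (m e x - v K x) \<partial>surface_measure e) = ?Im K e - ?Iv K e"
    if K: "K \<in> \<T>" and e: "e facet_of K" for K e
  proof -
    have eK: "e \<subseteq> K" using e by (rule facet_of_imp_subset)
    have c: "continuous_on e F" "continuous_on e (v K)" "continuous_on e (m e)"
      using continuous_on_subset[OF continuous_on_element[OF contF K] eK]
        continuous_on_subset[OF Lambda_h_continuous[OF v K] eK] Sigma_h_continuous[OF m K e] by auto
    have i: "integrable (surface_measure e) (\<lambda>x. (F x \<bullet> face_normal K e) * m e x)"
      "integrable (surface_measure e) (\<lambda>x. (F x \<bullet> face_normal K e) * v K x)"
      by (intro integrable_surface_measure[OF simplices[OF K] e] continuous_intros c)+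
    show ?thesis unfolding right_diff_distrib by (rule Bochner_Integration.integral_diff[OF i])
  qed
  have "bdry_inner \<T> (\<lambda>K e x. F x \<bullet> face_normal K e) (\<lambda>K e x. m e x - v K x)
      = (\<Sum>K\<in>\<T>. \<Sum>e | e facet_of K. ?Im K e - ?Iv K e)"
    unfolding bdry_inner_def by (intro sum.cong refl) (simp add: split)
  also have "\<dots> = bdry_inner \<T> (\<lambda>K e x. F x \<bullet> face_normal K e) (\<lambda>K e. m e)
      - (\<Sum>K\<in>\<T>. \<Sum>e | e facet_of K. ?Iv K e)"
    unfolding bdry_inner_def by (simp add: sum_subtractf)
  also have "\<dots> = - (\<Sum>K\<in>\<T>. \<Sum>e | e facet_of K. ?Iv K e)"
    using normal_flux_cancels[OF contF no_flow, of m]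
    by simp
  finally have bdry: "bdry_inner \<T> (\<lambda>K e x. F x \<bullet> face_normal K e) (\<lambda>K e x. m e x - v K x)
      = - (\<Sum>K\<in>\<T>. \<Sum>e | e facet_of K. ?Iv K e)" .
  have green: "integral\<^sup>L (lebesgue_on (interior K)) (\<lambda>x. F x \<bullet> grad K (v K) x)
      = (\<Sum>e | e facet_of K. ?Iv K e)
        - integral\<^sup>L (lebesgue_on (interior K)) (\<lambda>x. divg (closure \<Omega>) F x \<bullet> v K x)"
    if K: "K \<in> \<T>" for K
  proof -
    obtain E where E: "C1_ext K (v K) E" using Lambda_h_C1[OF v K] by blast
    have FK: "C1_ext K F D" using C1_ext_subset[OF F element_subset[OF K]] .
    have "divg K F x = divg (closure \<Omega>) F x" if "x \<in> interior K" for x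
      using divg_interior[OF FK that] divg_element[OF F K that] by simp
    then have "integral\<^sup>L (lebesgue_on (interior K)) (\<lambda>x. divg K F x * v K x)
        = integral\<^sup>L (lebesgue_on (interior K)) (\<lambda>x. divg (closure \<Omega>) F x \<bullet> v K x)"
      by (intro Bochner_Integration.integral_cong refl) (simp add: space_restrict_space)
    then show ?thesis using green_simplex[OF simplices[OF K] FK E] by simp
  qed
  show ?thesis
    unfolding bdry vol_inner_interior by (simp add: green sum_subtractf)
qed

lemma continuous_on_divg_element:
  assumes "C1_ext (closure \<Omega>) F D" "K \<in> \<T>"
  shows "continuous_on K (\<lambda>x. \<Sum>i\<in>UNIV. D x (axis i 1) $ i)"
  by (intro continuous_on_sum continuous_on_component continuous_on_element[OF C1_ext_D(2)[OF assms(1)] assms(2)])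

text \<open>
  The scheme evaluates the viscosity at a concentration \<open>c'\<close> that may differ from the concentration
  \<open>c\<close> of Darcy's law; the residual is the right-hand side.
\<close>

lemma darcy_law_consistent:
  assumes coeffs: "admissible_coefficients \<Omega> perm poro visc"
    and u: "continuous_on (closure \<Omega>) u" and p: "C1_ext (closure \<Omega>) p Dp"
    and darcy: "\<And>x. x \<in> \<Omega> \<Longrightarrow> u x = - (perm x / visc (c x)) *\<^sub>R grad (closure \<Omega>) p x"
    and c': "continuous_on (closure \<Omega>) c'" and \<tau>: "\<tau> \<in> Theta_h k \<T>"
  shows "vol_inner \<T> (\<lambda>K x. resistance visc perm x (c' x) *\<^sub>R u x) \<tau>
       + vol_inner \<T> (\<lambda>K. grad K p) \<tau>
       = vol_inner \<T> (\<lambda>K x. (resistance visc perm x (c' x) - resistance visc perm x (c x)) *\<^sub>R u x) \<tau>"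
proof -
  obtain l where l: "l > 0" "\<And>x. x \<in> \<Omega> \<Longrightarrow> l \<le> perm x"
    using coeffs by (auto simp: admissible_coefficients_def)
  have visc: "continuous_on UNIV visc" "\<And>s. visc s > 0"
    and perm: "perm \<in> borel_measurable (lebesgue_on \<Omega>)"
    using coeffs by (auto simp: admissible_coefficients_def)
  have "continuous_on K (\<lambda>x. visc (c' x) *\<^sub>R u x)" if "K \<in> \<T>" for K
    by (intro continuous_on_scaleR continuous_on_compose2[OF visc(1)] continuous_on_element[OF _ that] c' u)
      auto
  moreover have "(\<lambda>x. inverse (perm x)) \<in> borel_measurable (lebesgue_on \<Omega>)"
    using perm by (rule borel_measurable_inverse)
  moreover have "\<bar>inverse (perm x)\<bar> \<le> inverse l" if "x \<in> \<Omega>" for x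
    using l(1) l(2)[OF that] by (simp add: abs_inverse le_imp_inverse_le)
  ultimately have "integrable_product (\<lambda>K x. inverse (perm x) *\<^sub>R (visc (c' x) *\<^sub>R u x)) \<tau>"
    using Theta_h_continuous[OF \<tau>] by (intro integrable_product_weighted)
  then have i1: "integrable_product (\<lambda>K x. resistance visc perm x (c' x) *\<^sub>R u x) \<tau>"
    by (simp add: resistance_def divide_inverse mult.commute)
  have gp: "grad K p x = (\<chi> i. Dp x (axis i 1))" if "K \<in> \<T>" "x \<in> interior K" for K x
    using grad_interior[OF C1_ext_subset[OF p element_subset] that(2)] that(1) .
  have "integrable_product (\<lambda>K x. \<chi> i. Dp x (axis i 1)) \<tau>"
    by (intro integrable_product_continuous continuous_on_vec_lambda Theta_h_continuous[OF \<tau>]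
        continuous_on_element[OF C1_ext_D(2)[OF p]])
  then have i2: "integrable_product (\<lambda>K. grad K p) \<tau>"
    by (rule integrable_product_cong[rotated]) (simp add: gp)
  show ?thesis unfolding vol_inner_add[OF i1 i2]
  proof (rule vol_inner_cong)
    fix K x assume K: "K \<in> \<T>" and x: "x \<in> interior K"
    have x\<Omega>: "x \<in> \<Omega>" using interior_element_subset[OF K] x by blast
    have "grad K p x = grad (closure \<Omega>) p x"
      using grad_subset[OF p element_subset[OF K] x] .
    moreover have "perm x > 0" using l(1) l(2)[OF x\<Omega>] by linarith
    ultimately have "grad K p x = - (resistance visc perm x (c x)) *\<^sub>R u x"
      using darcy[OF x\<Omega>] visc(2)[of "c x"] by (simp add: resistance_def)
    then show "(resistance visc perm x (c' x) *\<^sub>R u x + grad K p x) \<bullet> \<tau> K x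
        = ((resistance visc perm x (c' x) - resistance visc perm x (c x)) *\<^sub>R u x) \<bullet> \<tau> K x"
      by (simp add: algebra_simps)
  qed
qed

text \<open>
  For the continuous problem \<open>c'\<close> is the current and \<open>c''\<close> the previous concentration, and the
  residual is due to the lagged viscosity; for the problem discretized in time both are the previous
  concentration.
\<close>

lemma flow_equation_consistent:
  assumes coeffs: "admissible_coefficients \<Omega> perm poro visc"
    and eqs: "mdp_equations \<Omega> perm poro visc d\<^sub>m d\<^sub>l d\<^sub>t q c_in c' c_t u p c"
    and c'': "continuous_on (closure \<Omega>) c''"
    and \<tau>: "\<tau> \<in> Theta_h k \<T>" and v: "v \<in> Lambda_h k \<T>" and m: "m \<in> Sigma_h k \<T>"
  shows "B_u \<T> visc perm (\<lambda>K. c'') (\<lambda>K. u, \<lambda>K. p, \<lambda>e. p) (\<tau>, v, m)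
       = - vol_inner \<T> (\<lambda>K. q) v
         + vol_inner \<T> (\<lambda>K x. (resistance visc perm x (c'' x) - resistance visc perm x (c' x)) *\<^sub>R u x) \<tau>"
proof -
  let ?S = "closure \<Omega>"
  have u: "C1_ext ?S u (\<lambda>x. frechet_derivative u (at x within ?S))"
    and p: "C1_ext ?S p (\<lambda>x. frechet_derivative p (at x within ?S))"
    using eqs by (auto simp: mdp_equations_def intro: C1_on_imp_C1_ext)
  have divu: "divg ?S u x = q x" and darcy: "u x = - (perm x / visc (c' x)) *\<^sub>R grad ?S p x"
    if "x \<in> \<Omega>" for x
    using eqs that by (auto simp: mdp_equations_def)
  have no_flow: "u x \<bullet> \<nu> = 0" if "x \<in> frontier \<Omega>" "domain_normal \<Omega> x \<nu>" for x \<nu>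
    using eqs that by (auto simp: mdp_equations_def)
  have q: "vol_inner \<T> (\<lambda>K. divg ?S u) v = vol_inner \<T> (\<lambda>K. q) v"
    using interior_element_subset by (intro vol_inner_cong) (auto simp: divu subset_iff)
  have zero: "bdry_inner \<T> (\<lambda>K e x. 0) g = 0" for g
    by (simp add: bdry_inner_def)
  show ?thesis
    using conservation_law_consistent[OF u no_flow v m]
      darcy_law_consistent[OF coeffs C1_ext_D(3)[OF u] p darcy c'' \<tau>]
    by (simp add: B_u_def zero q)
qed

text \<open>
  The equation holds up to the difference between the time derivative \<open>c_t\<close> of the problem and the
  backward difference quotient with the previous concentration \<open>c''\<close>.
\<close>

lemma transport_equation_consistent:
  assumes coeffs: "admissible_coefficients \<Omega> perm poro visc"
    and disp: "d\<^sub>m > 0" "d\<^sub>l \<ge> 0" "d\<^sub>t \<ge> 0"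
    and eqs: "mdp_equations \<Omega> perm poro visc d\<^sub>m d\<^sub>l d\<^sub>t q c_in c' c_t u p c"
    and c'': "continuous_on (closure \<Omega>) c''"
    and \<tau>: "\<tau> \<in> Theta_h k \<T>" and v: "v \<in> Lambda_h k \<T>" and m: "m \<in> Sigma_h k \<T>"
  shows "B_c \<T> \<Delta>t poro d\<^sub>m d\<^sub>l d\<^sub>t (\<lambda>K. u)
           (\<lambda>K. diffusive_flux \<Omega> poro d\<^sub>m d\<^sub>l d\<^sub>t u c, \<lambda>K. c, \<lambda>e. c) (\<tau>, v, m)
       = - vol_inner \<T> (\<lambda>K x. q x * source_conc (q x) (c_in x) (c x) + poro x / \<Delta>t * c'' x) v
         + vol_inner \<T> (\<lambda>K x. poro x * (c_t x - (c x - c'' x) / \<Delta>t)) v"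
proof -
  let ?S = "closure \<Omega>" and ?\<sigma> = "diffusive_flux \<Omega> poro d\<^sub>m d\<^sub>l d\<^sub>t u c"
  let ?F = "\<lambda>y. c y *\<^sub>R u y + ?\<sigma> y"
  have u: "C1_ext ?S u (\<lambda>x. frechet_derivative u (at x within ?S))"
    and c: "C1_ext ?S c (\<lambda>x. frechet_derivative c (at x within ?S))"
    and \<sigma>: "C1_ext ?S ?\<sigma> (\<lambda>x. frechet_derivative ?\<sigma> (at x within ?S))"
    using eqs by (auto simp: mdp_equations_def intro: C1_on_imp_C1_ext)
  have c_t: "continuous_on ?S c_t" using eqs by (simp add: mdp_equations_def)
  have source: "q x * source_conc (q x) (c_in x) (c x) = poro x * c_t x + divg ?S ?F x" if "x \<in> \<Omega>" for x
    using eqs that by (simp add: mdp_equations_def)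
  obtain D where F: "C1_ext ?S ?F D"
    using C1_ext_add[OF C1_ext_scaleR[OF c u] \<sigma>] by blast
  have no_flow: "?F x \<bullet> \<nu> = 0" if "x \<in> frontier \<Omega>" "domain_normal \<Omega> x \<nu>" for x \<nu>
    using eqs that by (auto simp: mdp_equations_def diffusive_flux_def inner_diff_left)
  obtain l b where poro: "poro \<in> borel_measurable (lebesgue_on \<Omega>)"
    "l > 0" "\<And>x. x \<in> \<Omega> \<Longrightarrow> l \<le> poro x" "\<And>x. x \<in> \<Omega> \<Longrightarrow> poro x \<le> b"
    using coeffs by (auto simp: admissible_coefficients_def)
  have storage: "integrable_product (\<lambda>K x. poro x * f x) v" if "continuous_on ?S f" for f
    using integrable_product_weighted[of poro b "\<lambda>K. f" v] poro Lambda_h_continuous[OF v]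
      continuous_on_element[OF that] by force
  have divF: "integrable_product (\<lambda>K. divg ?S ?F) v"
    using integrable_product_continuous[of "\<lambda>K x. \<Sum>i\<in>UNIV. D x (axis i 1) $ i" v,
        OF continuous_on_divg_element[OF F] Lambda_h_continuous[OF v]]
  proof (rule integrable_product_cong[rotated])
    fix K x assume "K \<in> \<T>" "x \<in> interior K"
    from divg_element[OF F this]
    show "divg ?S ?F x \<bullet> v K x = (\<Sum>i\<in>UNIV. D x (axis i 1) $ i) \<bullet> v K x" by (simp only:)
  qed
  have int: "integrable_product (\<lambda>K x. poro x * c x) v" "integrable_product (\<lambda>K x. poro x * c'' x) v"
    "integrable_product (\<lambda>K x. poro x * c_t x) v"
    using C1_ext_D(3)[OF c] c'' c_t by (auto intro: storage)
  let ?c = "vol_inner \<T> (\<lambda>K x. poro x * c x) v" and ?c'' = "vol_inner \<T> (\<lambda>K x. poro x * c'' x) v"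
    and ?ct = "vol_inner \<T> (\<lambda>K x. poro x * c_t x) v" and ?div = "vol_inner \<T> (\<lambda>K. divg ?S ?F) v"
  have rhs1: "vol_inner \<T> (\<lambda>K x. q x * source_conc (q x) (c_in x) (c x) + poro x / \<Delta>t * c'' x) v
      = ?ct + ?div + (1 / \<Delta>t) * ?c''"
  proof -
    have "vol_inner \<T> (\<lambda>K x. q x * source_conc (q x) (c_in x) (c x) + poro x / \<Delta>t * c'' x) v
        = vol_inner \<T> (\<lambda>K x. (poro x * c_t x + divg ?S ?F x) + (1 / \<Delta>t) * (poro x * c'' x)) v"
      using interior_element_subset by (intro vol_inner_cong) (auto simp: source subset_iff)
    also have "\<dots> = ?ct + ?div + (1 / \<Delta>t) * ?c''"
      using int divF by (simp only: vol_inner_add[symmetric] vol_inner_scale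
          integrable_product_add integrable_product_scale)
    finally show ?thesis .
  qed
  have rhs2: "vol_inner \<T> (\<lambda>K x. poro x * (c_t x - (c x - c'' x) / \<Delta>t)) v
      = ?ct + (- 1 / \<Delta>t) * ?c + (1 / \<Delta>t) * ?c''"
  proof -
    have "vol_inner \<T> (\<lambda>K x. poro x * (c_t x - (c x - c'' x) / \<Delta>t)) v
        = vol_inner \<T> (\<lambda>K x. (poro x * c_t x + (- 1 / \<Delta>t) * (poro x * c x)) + (1 / \<Delta>t) * (poro x * c'' x)) v"
      by (intro arg_cong2[where f="vol_inner \<T>"] refl ext) (simp add: field_simps diff_divide_distrib)
    also have "\<dots> = ?ct + (- 1 / \<Delta>t) * ?c + (1 / \<Delta>t) * ?c''"
      using int divF by (simp only: vol_inner_add[symmetric] vol_inner_scale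
          integrable_product_add integrable_product_scale)
    finally show ?thesis .
  qed
  have flux_law: "vol_inner \<T> (\<lambda>K x. matrix_inv (dispersion d\<^sub>m d\<^sub>l d\<^sub>t (poro x) (u x)) *v ?\<sigma> x + grad K c x) \<tau> = 0"
  proof -
    have "vol_inner \<T> (\<lambda>K x. matrix_inv (dispersion d\<^sub>m d\<^sub>l d\<^sub>t (poro x) (u x)) *v ?\<sigma> x + grad K c x) \<tau>
        = vol_inner \<T> (\<lambda>K x. 0) \<tau>"
    proof (rule vol_inner_cong)
      fix K x assume K: "K \<in> \<T>" and x: "x \<in> interior K"
      have x\<Omega>: "x \<in> \<Omega>" using interior_element_subset[OF K] x by blast
      have "poro x > 0" using poro(2) poro(3)[OF x\<Omega>] by linarith
      moreover have "grad K c x = grad ?S c x"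
        using grad_subset[OF c element_subset[OF K] x] .
      ultimately have "matrix_inv (dispersion d\<^sub>m d\<^sub>l d\<^sub>t (poro x) (u x)) *v ?\<sigma> x + grad K c x = 0"
        unfolding diffusive_flux_def
        by (simp add: dispersion_inverse[OF disp] linear_neg[OF matrix_vector_mul_linear])
      then show "(matrix_inv (dispersion d\<^sub>m d\<^sub>l d\<^sub>t (poro x) (u x)) *v ?\<sigma> x + grad K c x) \<bullet> \<tau> K x = 0 \<bullet> \<tau> K x"
        by simp
    qed
    then show ?thesis by (simp add: vol_inner_def)
  qed
  have zero: "bdry_inner \<T> (\<lambda>K e x. c x - c x) (\<lambda>K e x. \<tau> K x \<bullet> face_normal K e) = 0"
    by (simp add: bdry_inner_def)
  have upwind: "?\<sigma> x \<bullet> n + (u x \<bullet> n) * upwind (u x \<bullet> n) (c x) (c x) = ?F x \<bullet> n" for x n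
    by (simp add: upwind_def inner_add_left)
  have swap: "(\<lambda>K x. ?\<sigma> x + c x *\<^sub>R u x) = (\<lambda>K :: (real^'n) set. ?F)"
    by (simp add: fun_eq_iff add.commute)
  have "B_c \<T> \<Delta>t poro d\<^sub>m d\<^sub>l d\<^sub>t (\<lambda>K. u) (\<lambda>K. ?\<sigma>, \<lambda>K. c, \<lambda>e. c) (\<tau>, v, m)
      = - (1 / \<Delta>t) * ?c + (vol_inner \<T> (\<lambda>K. ?F) (\<lambda>K. grad K (v K))
        + bdry_inner \<T> (\<lambda>K e x. ?F x \<bullet> face_normal K e) (\<lambda>K e x. m e x - v K x))"
    unfolding B_c_def prod.case zero flux_law upwind swap by simp
  also have "\<dots> = - (1 / \<Delta>t) * ?c - ?div"
    using conservation_law_consistent[OF F no_flow v m] by linarith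
  finally show ?thesis unfolding rhs1 rhs2 by simp
qed

end

lemma polyhedral_mesh:
  assumes "polyhedral_domain \<Omega>" "quasi_uniform_mesh \<kappa> \<Omega> \<T>"
  shows "simplicial_mesh \<Omega> \<T>"
  using assms by (auto simp: simplicial_mesh_def polyhedral_domain_def quasi_uniform_mesh_def)

lemma time_level_bounds:
  assumes "T > 0" "M > 0" "n \<le> M"
  shows "time_level T M n \<in> {0..T}" and "n > 0 \<Longrightarrow> time_level T M n \<in> {0<..T}"
proof -
  have "real n * T \<le> real M * T" using assms by (intro mult_right_mono) auto
  then show "time_level T M n \<in> {0..T}" and "n > 0 \<Longrightarrow> time_level T M n \<in> {0<..T}"
    using assms by (auto simp: time_level_def time_step_def field_simps)
qed

theorem theorem2p1:
  fixes \<Omega> :: "(real^'n) set" and \<T> :: "(real^'n) set set"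
    and T d\<^sub>m d\<^sub>l d\<^sub>t \<kappa> :: real and M k :: nat
    and perm poro c0 :: "real^'n \<Rightarrow> real" and visc :: "real \<Rightarrow> real"
    and q c_in p c :: "real \<Rightarrow> real^'n \<Rightarrow> real" and u :: "real \<Rightarrow> real^'n \<Rightarrow> real^'n"
  assumes dim: "CARD('n) = 2 \<or> CARD('n) = 3"
    and domain: "polyhedral_domain \<Omega>"
    and mesh: "quasi_uniform_mesh \<kappa> \<Omega> \<T>"
    and coeffs: "admissible_coefficients \<Omega> perm poro visc"
    and disp: "d\<^sub>m > 0" "d\<^sub>l \<ge> 0" "d\<^sub>t \<ge> 0"
    and time: "T > 0" "M > 0"
  shows
    "(mdp_solution \<Omega> T perm poro visc d\<^sub>m d\<^sub>l d\<^sub>t q c_in c0 u p c \<longrightarrow>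
       (\<forall>n\<in>{1..M}. \<forall>\<tau>\<in>Theta_h k \<T>. \<forall>v\<in>Lambda_h k \<T>. \<forall>m\<in>Sigma_h k \<T>.
          let \<Delta>t = time_step T M; t = time_level T M n; t' = time_level T M (n - 1);
              \<sigma> = diffusive_flux \<Omega> poro d\<^sub>m d\<^sub>l d\<^sub>t (u t) (c t)
          in B_u \<T> visc perm (\<lambda>K. c t') (\<lambda>K. u t, \<lambda>K. p t, \<lambda>e. p t) (\<tau>, v, m)
               = - vol_inner \<T> (\<lambda>K. q t) v
                 + vol_inner \<T> (\<lambda>K x. (resistance visc perm x (c t' x)
                                        - resistance visc perm x (c t x)) *\<^sub>R u t x) \<tau>
           \<and> B_c \<T> \<Delta>t poro d\<^sub>m d\<^sub>l d\<^sub>t (\<lambda>K. u t) (\<lambda>K. \<sigma>, \<lambda>K. c t, \<lambda>e. c t) (\<tau>, v, m)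
               = - vol_inner \<T> (\<lambda>K x. q t x * source_conc (q t x) (c_in t x) (c t x)
                                       + poro x / \<Delta>t * c t' x) v
                 + vol_inner \<T> (\<lambda>K x. poro x * (time_deriv T c t x
                                                - (c t x - c t' x) / \<Delta>t)) v))
     \<and>
     (mdp_time_discrete_solution \<Omega> T M perm poro visc d\<^sub>m d\<^sub>l d\<^sub>t q c_in c0 u p c \<longrightarrow>
       (\<forall>n\<in>{1..M}. \<forall>\<tau>\<in>Theta_h k \<T>. \<forall>v\<in>Lambda_h k \<T>. \<forall>m\<in>Sigma_h k \<T>.
          let \<Delta>t = time_step T M; t = time_level T M n; t' = time_level T M (n - 1);
              \<sigma> = diffusive_flux \<Omega> poro d\<^sub>m d\<^sub>l d\<^sub>t (u t) (c t)
          in B_u \<T> visc perm (\<lambda>K. c t') (\<lambda>K. u t, \<lambda>K. p t, \<lambda>e. p t) (\<tau>, v, m)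
               = - vol_inner \<T> (\<lambda>K. q t) v
           \<and> B_c \<T> \<Delta>t poro d\<^sub>m d\<^sub>l d\<^sub>t (\<lambda>K. u t) (\<lambda>K. \<sigma>, \<lambda>K. c t, \<lambda>e. c t) (\<tau>, v, m)
               = - vol_inner \<T> (\<lambda>K x. q t x * source_conc (q t x) (c_in t x) (c t x)
                                       + poro x / \<Delta>t * c t' x) v))"
proof -
  interpret simplicial_mesh \<Omega> \<T>
    using domain mesh by (rule polyhedral_mesh)
  show ?thesis
    unfolding Let_def
  proof (rule conjI; rule impI; rule ballI; rule ballI; rule ballI; rule ballI)
    fix n \<tau> v m
    let ?t = "time_level T M n" and ?t' = "time_level T M (n - 1)"
    assume sol: "mdp_solution \<Omega> T perm poro visc d\<^sub>m d\<^sub>l d\<^sub>t q c_in c0 u p c"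
      and n: "n \<in> {1..M}"
      and test: "\<tau> \<in> Theta_h k \<T>" "v \<in> Lambda_h k \<T>" "m \<in> Sigma_h k \<T>"
    have "?t \<in> {0<..T}" "?t' \<in> {0..T}"
      using n time_level_bounds[OF time] by auto
    then have eqs: "mdp_equations \<Omega> perm poro visc d\<^sub>m d\<^sub>l d\<^sub>t (q ?t) (c_in ?t)
        (c ?t) (time_deriv T c ?t) (u ?t) (p ?t) (c ?t)"
      and c': "continuous_on (closure \<Omega>) (c ?t')"
      using sol unfolding mdp_solution_def by blast+
    note both = conjI[OF flow_equation_consistent[OF coeffs eqs c' test]
        transport_equation_consistent[OF coeffs disp eqs c' test]]
    show "B_u \<T> visc perm (\<lambda>K. c ?t') (\<lambda>K. u ?t, \<lambda>K. p ?t, \<lambda>e. p ?t) (\<tau>, v, m)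
        = - vol_inner \<T> (\<lambda>K. q ?t) v
          + vol_inner \<T> (\<lambda>K x. (resistance visc perm x (c ?t' x) - resistance visc perm x (c ?t x)) *\<^sub>R u ?t x) \<tau>
      \<and> B_c \<T> (time_step T M) poro d\<^sub>m d\<^sub>l d\<^sub>t (\<lambda>K. u ?t)
          (\<lambda>K. diffusive_flux \<Omega> poro d\<^sub>m d\<^sub>l d\<^sub>t (u ?t) (c ?t), \<lambda>K. c ?t, \<lambda>e. c ?t) (\<tau>, v, m)
        = - vol_inner \<T> (\<lambda>K x. q ?t x * source_conc (q ?t x) (c_in ?t x) (c ?t x)
            + poro x / time_step T M * c ?t' x) v
          + vol_inner \<T> (\<lambda>K x. poro x * (time_deriv T c ?t x - (c ?t x - c ?t' x) / time_step T M)) v"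
      by (rule both)
  next
    fix n \<tau> v m
    let ?t = "time_level T M n" and ?t' = "time_level T M (n - 1)"
    assume sol: "mdp_time_discrete_solution \<Omega> T M perm poro visc d\<^sub>m d\<^sub>l d\<^sub>t q c_in c0 u p c"
      and n: "n \<in> {1..M}"
      and test: "\<tau> \<in> Theta_h k \<T>" "v \<in> Lambda_h k \<T>" "m \<in> Sigma_h k \<T>"
    let ?c_t = "\<lambda>x. (c ?t x - c ?t' x) / time_step T M"
    have step: "mdp_equations \<Omega> perm poro visc d\<^sub>m d\<^sub>l d\<^sub>t (q (time_level T M j)) (c_in (time_level T M j))
        (c (time_level T M (j - 1))) (\<lambda>x. (c (time_level T M j) x - c (time_level T M (j - 1)) x) / time_step T M)
        (u (time_level T M j)) (p (time_level T M j)) (c (time_level T M j))" if "j \<in> {1..M}" for j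
      using sol that unfolding mdp_time_discrete_solution_def Let_def by blast
    have c': "continuous_on (closure \<Omega>) (c ?t')"
    proof (cases "n = 1")
      case True
      then show ?thesis using sol by (simp add: mdp_time_discrete_solution_def time_level_def)
    next
      case False
      then have "n - 1 \<in> {1..M}" using n by auto
      from step[OF this] have "C1_on (closure \<Omega>) (c ?t')"
        unfolding mdp_equations_def by blast
      then show ?thesis by (rule C1_ext_D(3)[OF C1_on_imp_C1_ext])
    qed
    have residuals: "vol_inner \<T> (\<lambda>K x. (resistance visc perm x (c ?t' x) - resistance visc perm x (c ?t' x)) *\<^sub>R u ?t x) \<tau> = 0"
      "vol_inner \<T> (\<lambda>K x. poro x * (?c_t x - ?c_t x)) v = 0"
      by (simp_all add: vol_inner_def)
    show "B_u \<T> visc perm (\<lambda>K. c ?t') (\<lambda>K. u ?t, \<lambda>K. p ?t, \<lambda>e. p ?t) (\<tau>, v, m)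
        = - vol_inner \<T> (\<lambda>K. q ?t) v
      \<and> B_c \<T> (time_step T M) poro d\<^sub>m d\<^sub>l d\<^sub>t (\<lambda>K. u ?t)
          (\<lambda>K. diffusive_flux \<Omega> poro d\<^sub>m d\<^sub>l d\<^sub>t (u ?t) (c ?t), \<lambda>K. c ?t, \<lambda>e. c ?t) (\<tau>, v, m)
        = - vol_inner \<T> (\<lambda>K x. q ?t x * source_conc (q ?t x) (c_in ?t x) (c ?t x)
            + poro x / time_step T M * c ?t' x) v"
      using flow_equation_consistent[OF coeffs step[OF n] c' test]
        transport_equation_consistent[OF coeffs disp step[OF n] c' test, of "time_step T M"]
      unfolding residuals by simp
  qed
qed

end
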